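(* For every integer $k\ge 1$ and every $\delta\in(0,\pi)$, $$\int_{-\infty}^{\infty} \left|\zeta\left(\tfrac12+it\right)\right|^{2k}\frac{e^{k(\pi-\delta)t}}{\cosh(\pi t)^k}\,dt = 2\,\frac{e^{ik\frac{\delta-\pi}{2}}}{\pi^{k-1}}\int_{\mathbb{R}_{>0}^{k}}\ \prod_{j=1}^{k}A(-u_je^{i\delta})\ \delta_1\Big(\prod_{j=1}^k u_j\Big)\prod_{j=1}^k du_j .$$
   Context: $\zeta$ is the Riemann zeta function, $\mathbb{R}_{>0}=(0,\infty)$, $\mathbb{C}'=\mathbb{C}\setminus(-\infty,0]$, and $i^2=-1$. The function $A$ is defined for $\Re(z)>0$ by $$A(z)=\int_0^\infty\left(\frac1{xz}-\frac1{e^{xz}-1}\right)\left(\frac1x-\frac1{e^x-1}\right)dx,$$ and extends analytically to $\mathbb{C}'$; the same letter $A$ denotes this analytic continuation. (The continuation is given by $A(z)=\frac1{2\pi}\int_{-\infty}^\infty z^{-1/2+it}\,|\zeta(\tfrac12+it)|^2\,\frac{\pi\,dt}{\cosh(\pi t)}$, with $z^{-1/2+it}=e^{(-1/2+it)\log z}$ and $\log$ the principal branch.) $\delta_1(u_1\cdots u_k)\,du_1\cdots du_k$ denotes the (weighted) surface measure supported on $\{u_1\cdots u_k=1\}\subset\mathbb{R}_{>0}^k$ which, seen as a distribution, is $\lim_{\varepsilon\to0^+}\varepsilon^{-1}\mathbf{1}_{1\le u_1\cdots u_k\le 1+\varepsilon}\,du_1\cdots du_k$. For $k=1$ it is the Dirac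 mass at $1$; for $k\ge2$ it is the image of the measure $\prod_{j=1}^{k-1}\frac{du_j}{u_j}$ on $\mathbb{R}_{>0}^{k-1}$ under $(u_1,\dots,u_{k-1})\mapsto(u_1,\dots,u_{k-1},(u_1\cdots u_{k-1})^{-1})$. (The symbol $\delta_1(\cdot)$ is unrelated to the parameter $\delta$.) *)

theory Defs
  imports "HOL-Probability.Probability" "HOL-Complex_Analysis.Complex_Analysis"
begin

text \<open>The value outside \<open>V\<close> is normalised to \<open>0\<close> so that the continuation is unique as a
  total function; for the notion to make sense, \<open>U\<close> is nonempty and open, \<open>V\<close> is open
  and connected, and \<open>U \<subseteq> V\<close>.\<close>

definition analytic_continuation ::
    "complex set \<Rightarrow> complex set \<Rightarrow> (complex \<Rightarrow> complex) \<Rightarrow> complex \<Rightarrow> complex" where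
  "analytic_continuation U V f =
     (THE g. g holomorphic_on V \<and> (\<forall>z\<in>U. g z = f z) \<and> (\<forall>z. z \<notin> V \<longrightarrow> g z = 0))"

lemma analytic_continuation_eqI:
  assumes "open U" "U \<noteq> {}" "U \<subseteq> V" "open V" "connected V"
    and "g holomorphic_on V" "\<And>z. z \<in> U \<Longrightarrow> g z = f z" "\<And>z. z \<notin> V \<Longrightarrow> g z = 0"
  shows "analytic_continuation U V f = g"
  unfolding analytic_continuation_def
proof (rule the_equality)
  fix h
  assume h: "h holomorphic_on V \<and> (\<forall>z\<in>U. h z = f z) \<and> (\<forall>z. z \<notin> V \<longrightarrow> h z = 0)"
  show "h = g"
  proof
    fix z
    show "h z = g z"
    proof (cases "z \<in> V")
      case True
      show ?thesis
        by (rule analytic_continuation_open[where s = U and s' = V and f = h and g = g])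
          (use assms h True in auto)
    qed (use assms h in auto)
  qed
qed (use assms in auto)

definition zeta :: "complex \<Rightarrow> complex" where
  "zeta = analytic_continuation {s. Re s > 1} (- {1})
     (\<lambda>s. \<Sum>n. 1 / of_nat (Suc n) powr s)"

definition A_integral :: "complex \<Rightarrow> complex" where
  "A_integral z =
     (LINT x:{0<..}|lborel.
        (1 / (of_real x * z) - 1 / (exp (of_real x * z) - 1)) *
        of_real (1 / x - 1 / (exp x - 1)))"

text \<open>The domain \<open>- \<real>\<^sub>\<le>\<^sub>0\<close> is the slit plane.\<close>

definition A_fun :: "complex \<Rightarrow> complex" where
  "A_fun = analytic_continuation {z. Re z > 0} (- \<real>\<^sub>\<le>\<^sub>0) A_integral"

text \<open>The measure \<open>du/u\<close> on the positive half-line.\<close>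

definition mult_haar :: "real measure" where
  "mult_haar = density (restrict_space lborel {0<..}) (\<lambda>u. ennreal (1 / u))"

text \<open>The measure \<open>\<delta>\<^sub>1(u\<^sub>0\<cdots>u\<^bsub>k-1\<^esub>) du\<^sub>0\<cdots>du\<^bsub>k-1\<^esub>\<close>
  for \<open>k \<ge> 1\<close>, whose underlying space is the set of \<open>k\<close>-tuples of positive reals (as
  extensional functions on \<open>{..<k}\<close>). For \<open>k = 1\<close> the product measure is the unit mass on
  the empty tuple and the empty product is 1, so this is the Dirac mass at 1.\<close>

definition delta1_measure :: "nat \<Rightarrow> (nat \<Rightarrow> real) measure" where
  "delta1_measure k =
     distr (Pi\<^sub>M {..<k - 1} (\<lambda>_. mult_haar))
           (Pi\<^sub>M {..<k} (\<lambda>_. restrict_space lborel {0<..}))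
           (\<lambda>u. \<lambda>j\<in>{..<k}. if j < k - 1 then u j else inverse (\<Prod>i<k - 1. u i))"

lemma delta1_map_measurable:
  "(\<lambda>u. \<lambda>j\<in>{..<k}. if j < k - 1 then u j else inverse (\<Prod>i<k - 1. u i))
   \<in> measurable (Pi\<^sub>M {..<k - 1} (\<lambda>_. mult_haar))
       (Pi\<^sub>M {..<k} (\<lambda>_. restrict_space lborel ({0<..}::real set)))"
proof -
  have s: "sets mult_haar = sets (restrict_space borel {0<..})" by (simp add: mult_haar_def sets_restrict_space)
  have sp: "space mult_haar = {0<..}" by (simp add: mult_haar_def space_restrict_space)
  have c: "(\<lambda>u. u i) \<in> borel_measurable (Pi\<^sub>M {..<k - 1} (\<lambda>_. mult_haar))" if "i < k-1" for i
  proof -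
    have "(\<lambda>u. u i) \<in> measurable (Pi\<^sub>M {..<k - 1} (\<lambda>_. mult_haar)) mult_haar" using that by (auto intro: measurable_component_singleton)
    then have "(\<lambda>u. u i) \<in> measurable (Pi\<^sub>M {..<k - 1} (\<lambda>_. mult_haar)) (restrict_space borel {0<..})" 
      using measurable_cong_sets[OF refl s] by blast
    then show ?thesis by (simp add: measurable_restrict_space2_iff)
  qed
  show ?thesis
    apply (rule measurable_restrict)
    subgoal for i
      apply (rule measurable_restrict_space2)
       apply (auto simp: space_PiM sp PiE_iff intro!: prod_pos)[1]
      using borel_measurable_inverse[OF borel_measurable_prod[of "{..<k-1}" "\<lambda>i u. u i", OF c]]
      by (cases "i < k-1") (auto intro!: c)
    done
qed

end

theory Submission
  imports Defs
begin

text \<open>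
  Write \<open>\<phi>(z) = 1/z - 1/(e\<^sup>z - 1)\<close>, so that \<open>A(z) = \<integral> \<phi>(xz) \<phi>(x) dx\<close>, and pass to the
  additive group by \<open>x = e\<^sup>y\<close>. For \<open>\<bar>\<beta>\<bar> < \<pi>/2\<close> put \<open>g\<^sub>\<beta>(y) = e\<^bsup>y/2\<^esup> \<phi>(e\<^bsup>y + i\<beta>\<^esup>)\<close> (the
  function \<open>ray \<beta>\<close>) and let \<open>F\<^sub>\<beta>\<close> be its Fourier transform. The function \<open>g\<^sub>\<beta>\<close> decays like
  \<open>e\<^bsup>-\<bar>y\<bar>/2\<^esup>\<close>, and three facts about it carry the proof.

  \<^item> \<open>F\<^sub>0(t) = -\<Gamma>(s) \<zeta>(s)\<close> with \<open>s = 1/2 + it\<close> (\<open>fourier_ray_0_zeta\<close>). This is the Mellin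
    transform of \<open>\<phi>\<close> in the critical strip (\<open>phi_mellin\<close>), and it comes out of the same
    decomposition of \<open>\<Gamma>(s) \<zeta>(s)\<close> that continues \<open>\<zeta>\<close> to the punctured plane (\<open>zeta_eq\<close>).

  \<^item> Rotating the path of integration by \<open>\<beta>\<close> multiplies the transform by \<open>e\<^bsup>\<beta>t\<^esup>\<close> and a phase
    (\<open>fourier_ray\<close>). Since \<open>\<bar>\<Gamma>(1/2 + it)\<bar>\<^sup>2 = \<pi> / cosh(\<pi>t)\<close>, this gives
    \<open>\<bar>F\<^sub>\<beta>(t)\<bar>\<^sup>2 = \<pi> \<bar>\<zeta>(1/2 + it)\<bar>\<^sup>2 e\<^bsup>2\<beta>t\<^esup> / cosh(\<pi>t)\<close>; and as each \<open>F\<^sub>\<beta>\<close> is bounded,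
    angles close to \<open>\<plusminus>\<pi>/2\<close> yield the exponential decay behind all convergence questions.

  \<^item> The autocorrelation of \<open>g\<^sub>\<beta>\<close> has the Fourier transform \<open>\<bar>F\<^sub>\<beta>\<bar>\<^sup>2\<close>, which is integrable, so
    Fourier inversion recovers the one from the other (\<open>autocorr_ray\<close>).

  On the positive axis \<open>z\<^bsup>1/2\<^esup> A(z)\<close> is the autocorrelation of \<open>g\<^sub>0\<close> at \<open>ln z\<close>. Inversion turns this
  into a Fourier integral that converges and is holomorphic on the whole slit plane, hence it is the
  continuation of \<open>A\<close> (\<open>A_fun_eq\<close>). On the ray \<open>z = -u e\<^bsup>i\<delta>\<^esup>\<close>, of argument \<open>-(\<pi> - \<delta>)\<close>, the same
  integral is, up to the factor \<open>u\<^bsup>-1/2\<^esup>\<close> and a phase, the autocorrelation of \<open>g\<^sub>\<beta>\<close> with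
  \<open>\<beta> = -(\<pi> - \<delta>)/2\<close> at \<open>ln u\<close>: half of the rotation goes to each of the two factors \<open>\<phi>\<close>
  (\<open>A_fun_on_ray\<close>). In particular \<open>u\<^bsup>1/2\<^esup> A(-u e\<^bsup>i\<delta>\<^esup>)\<close> is integrable with respect to \<open>du/u\<close>.

  The right-hand side of the theorem is thus a \<open>k\<close>-fold convolution of this autocorrelation with
  itself, evaluated at the identity of the multiplicative group; the powers \<open>u\<^sub>j\<^bsup>-1/2\<^esup>\<close> cancel on
  \<open>u\<^sub>1 \<cdots> u\<^sub>k = 1\<close>. The Fourier transform takes the convolution to the \<open>k\<close>-th power of
  \<open>\<bar>F\<^sub>\<beta>\<bar>\<^sup>2\<close>, so its value at the identity is the integral of that power
  (\<open>multiplicative_convolution_at_1\<close>), which is the left-hand side.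
\<close>

section \<open>Integrals depending holomorphically on a parameter\<close>

text \<open>
  Dominated convergence applies to the difference quotients because Cauchy's estimate bounds the
  derivative on a smaller disc by the dominating function of the larger one.
\<close>
lemma holomorphic_on_parametric_integral:
  fixes f :: "complex \<Rightarrow> 'a \<Rightarrow> complex"
  assumes S: "open S"
    and meas: "\<And>z. z \<in> S \<Longrightarrow> f z \<in> borel_measurable M"
    and holo: "\<And>x. x \<in> space M \<Longrightarrow> (\<lambda>z. f z x) holomorphic_on S"
    and dom: "\<And>z. z \<in> S \<Longrightarrow> \<exists>r>0. \<exists>w. integrable M w \<and> cball z r \<subseteq> S \<and>
                 (\<forall>x\<in>space M. \<forall>y\<in>cball z r. norm (f y x) \<le> w x)"
  shows "(\<lambda>z. LINT x|M. f z x) holomorphic_on S"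
proof -
  have "(\<lambda>z. LINT x|M. f z x) field_differentiable (at z)" if z: "z \<in> S" for z
  proof -
    obtain r w where r: "r > 0" and w: "integrable M w" and sub: "cball z r \<subseteq> S"
      and bd: "\<And>x y. x \<in> space M \<Longrightarrow> y \<in> cball z r \<Longrightarrow> norm (f y x) \<le> w x"
      using dom[OF z] by metis
    have int: "integrable M (f y)" if "y \<in> cball z r" for y
      by (rule Bochner_Integration.integrable_bound[OF w])
         (use meas bd that sub in \<open>fastforce intro!: AE_I2\<close>)+
    \<comment> \<open>the difference quotients are dominated by Cauchy's estimate on a circle\<close>
    have der: "norm (deriv (\<lambda>y. f y x) y) \<le> w x / (r/2)" if "y \<in> cball z (r/2)" "x \<in> space M" for x y
    proof -
      have "norm ((deriv ^^ 1) (\<lambda>y. f y x) y) \<le> fact 1 * w x / (r/2) ^ 1"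
      proof (rule Cauchy_inequality)
        have sb: "cball y (r/2) \<subseteq> cball z r"
        proof
          fix u assume "u \<in> cball y (r/2)"
          with that(1) show "u \<in> cball z r" 
            using dist_triangle[of z u y] by (simp add: dist_commute)
        qed
        have h: "(\<lambda>y. f y x) holomorphic_on cball z r"
          using holo[OF that(2)] sub by (rule holomorphic_on_subset)
        show "(\<lambda>y. f y x) holomorphic_on ball y (r/2)"
          using h sb by (meson ball_subset_cball holomorphic_on_subset order_trans)
        show "continuous_on (cball y (r/2)) (\<lambda>y. f y x)"
          using h sb by (meson continuous_on_subset holomorphic_on_imp_continuous_on)
        show "cmod (f u x) \<le> w x" if "norm (y - u) = r/2" for u
          using sb bd[OF \<open>x \<in> space M\<close>, of u] that by (auto simp: dist_norm)
      qed (use r in auto)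
      then show ?thesis by simp
    qed
    define D where "D = (LINT x|M. deriv (\<lambda>y. f y x) z)"
    have "((\<lambda>y. ((LINT x|M. f y x) - (LINT x|M. f z x)) / (y - z)) \<longlongrightarrow> D) (at z)"
      unfolding tendsto_at_iff_sequentially comp_def
    proof (intro allI impI)
      fix X :: "nat \<Rightarrow> complex"
      assume X: "\<forall>i. X i \<in> UNIV - {z}" and lim: "X \<longlonglongrightarrow> z"
      have "\<forall>\<^sub>F n in sequentially. dist (X n) z < r/2"
        using lim r by (intro tendstoD) auto
      then obtain N where N: "\<And>n. n \<ge> N \<Longrightarrow> dist (X n) z < r/2"
        by (auto simp: eventually_sequentially)
      define Y where "Y = (\<lambda>n. X (n + N))"
      have Y: "Y n \<noteq> z" "Y n \<in> cball z (r/2)" "Y n \<in> cball z r" for n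
        using X N[of "n+N"] r by (auto simp: Y_def dist_commute)
      have Ylim: "Y \<longlonglongrightarrow> z" unfolding Y_def using lim by (rule LIMSEQ_ignore_initial_segment)
      have zz: "z \<in> cball z r" using r by auto
      have conv: "(\<lambda>n. (f (Y n) x - f z x) / (Y n - z)) \<longlonglongrightarrow> deriv (\<lambda>y. f y x) z" if "x \<in> space M" for x
      proof -
        have "((\<lambda>y. f y x) has_field_derivative deriv (\<lambda>y. f y x) z) (at z)"
          using holo[OF that] S z by (rule holomorphic_derivI)
        then have "((\<lambda>y. (f y x - f z x) / (y - z)) \<longlongrightarrow> deriv (\<lambda>y. f y x) z) (at z)"
          by (simp add: has_field_derivative_iff)
        then show ?thesis
          using Y(1) Ylim unfolding tendsto_at_iff_sequentially comp_def by auto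
      qed
      have "(\<lambda>n. LINT x|M. (f (Y n) x - f z x) / (Y n - z)) \<longlonglongrightarrow> D"
        unfolding D_def
      proof (rule integral_dominated_convergence[where w = "\<lambda>x. w x / (r/2)"])
        show m: "(\<lambda>x. (f (Y n) x - f z x) / (Y n - z)) \<in> borel_measurable M" for n
          using int[OF Y(3)[of n]] int[OF zz] by (auto intro: borel_measurable_integrable)
        show "(\<lambda>x. deriv (\<lambda>y. f y x) z) \<in> borel_measurable M"
          by (rule borel_measurable_LIMSEQ_metric[OF m conv])
        show "integrable M (\<lambda>x. w x / (r/2))" using w by auto
        show "AE x in M. (\<lambda>n. (f (Y n) x - f z x) / (Y n - z)) \<longlonglongrightarrow> deriv (\<lambda>y. f y x) z"
          using conv by auto
        show "AE x in M. norm ((f (Y n) x - f z x) / (Y n - z)) \<le> w x / (r/2)" for n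
        proof (rule AE_I2)
          fix x assume x: "x \<in> space M"
          have "norm (f (Y n) x - f z x) \<le> (w x / (r/2)) * norm (Y n - z)"
          proof (rule field_differentiable_bound[where S = "cball z (r/2)" and f' = "deriv (\<lambda>y. f y x)"])
            fix u assume u: "u \<in> cball z (r/2)"
            then have "u \<in> S" using sub r by auto
            then show "((\<lambda>y. f y x) has_field_derivative deriv (\<lambda>y. f y x) u) (at u within cball z (r/2))"
              using holo[OF x] S by (meson holomorphic_derivI)
          qed (use der x Y r in auto)
          then show "norm ((f (Y n) x - f z x) / (Y n - z)) \<le> w x / (r/2)"
            using Y(1)[of n] r by (simp add: norm_divide divide_simps)
        qed
      qed
      moreover have "(LINT x|M. (f (Y n) x - f z x) / (Y n - z))
          = ((LINT x|M. f (Y n) x) - (LINT x|M. f z x)) / (Y n - z)" for n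
        using int[OF Y(3)[of n]] int[OF zz] by simp
      ultimately have "(\<lambda>n. ((LINT x|M. f (Y n) x) - (LINT x|M. f z x)) / (Y n - z)) \<longlonglongrightarrow> D" by (simp only:)
      then show "(\<lambda>n. ((LINT x|M. f (X n) x) - (LINT x|M. f z x)) / (X n - z)) \<longlonglongrightarrow> D"
        unfolding Y_def by (rule LIMSEQ_offset)
    qed
    then show ?thesis
      unfolding field_differentiable_def has_field_derivative_iff by blast
  qed
  then show ?thesis using S by (simp add: holomorphic_on_def field_differentiable_at_within)
qed

section \<open>Logarithmic coordinates on the positive half-line\<close>

lemma integrable_eq: "integrable M f \<Longrightarrow> (\<And>x. f x = g x) \<Longrightarrow> integrable M g"
  by (simp cong: Bochner_Integration.integrable_cong)

lemma integrable_exp_minus_abs: "integrable lborel (\<lambda>y::real. exp (- (c * \<bar>y\<bar>)))" if "c > 0" for c :: real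
proof -
  have 1: "integrable lborel (\<lambda>x. indicator {0<..} x * exp (- (x * c)))"
    using integrable_I0i_exp_mscale[OF that] by (simp add: set_integrable_def)
  have "integrable lborel (\<lambda>x. indicator {0<..} x * exp (- (x * c)) + indicator {0<..} (- x) * exp (- (- x * c)))"
    using lborel_integrable_real_affine[OF 1, of "-1" 0] 1 by simp
  moreover have "AE x in lborel. (x::real) \<noteq> 0" by (rule AE_lborel_singleton)
  then have "AE x in lborel. indicator {0<..} x * exp (- (x * c)) + indicator {0<..} (- x) * exp (- (- x * c)) = exp (- (c * \<bar>x\<bar>))"
    by eventually_elim (auto simp: indicator_def abs_if mult.commute)
  ultimately show ?thesis
    by (subst integrable_cong_AE[symmetric]) auto
qed

text \<open>
  The library has the substitution rule on compact intervals; the half-line is exhausted by the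
  images of \<open>[-n, n]\<close> and both sides converge monotonically.
\<close>
lemma nn_integral_exp_substitution:
  fixes f :: "real \<Rightarrow> ennreal"
  assumes [measurable]: "f \<in> borel_measurable borel"
  shows "(\<integral>\<^sup>+x. f x * indicator {0<..} x \<partial>lborel) = (\<integral>\<^sup>+y. f (exp y) * ennreal (exp y) \<partial>lborel)"
proof -
  have step: "(\<integral>\<^sup>+x. f x * indicator {exp (-real (Suc n))..exp (real (Suc n))} x \<partial>lborel)
     = (\<integral>\<^sup>+y. f (exp y) * ennreal (exp y) * indicator {-real (Suc n)..real (Suc n)} y \<partial>lborel)" for n
    by (rule nn_integral_substitution_aux[where g=exp and g'=exp])
       (auto intro!: DERIV_exp continuous_intros)
  have inc: "incseq (\<lambda>n. {-real (Suc n)..real (Suc n)})" "incseq (\<lambda>n. {exp (-real (Suc n))..exp (real (Suc n))})"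
    by (auto simp: incseq_def intro: order_trans)
  have un: "(\<Union>n. {-real (Suc n)..real (Suc n)}) = UNIV"
  proof -
    have "\<exists>n. x \<in> {-real (Suc n)..real (Suc n)}" for x
    proof -
      obtain n where "\<bar>x\<bar> \<le> real n" using real_arch_simple by blast
      then show ?thesis by (intro exI[of _ n]) auto
    qed
    then show ?thesis by blast
  qed
  have un2: "(\<Union>n. {exp (-real (Suc n))..exp (real (Suc n))}) = {0<..}"
  proof -
    have "\<exists>n. x \<in> {exp (-real (Suc n))..exp (real (Suc n))}" if "x > 0" for x
    proof -
      have "ln x \<in> (\<Union>n. {-real (Suc n)..real (Suc n)})" unfolding un by simp
      then obtain n where "ln x \<in> {-real (Suc n)..real (Suc n)}" by blast
      then have "exp (-real (Suc n)) \<le> exp (ln x) \<and> exp (ln x) \<le> exp (real (Suc n))" by (simp only: exp_le_cancel_iff) simp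
      with that show ?thesis by (intro exI[of _ n]) auto
    qed
    moreover have "x > 0" if "exp (- real (Suc n)) \<le> x" for x n
      using that exp_gt_zero less_le_trans by blast
    ultimately show ?thesis by fastforce
  qed
  have l: "(\<lambda>n. \<integral>\<^sup>+x. g x * indicator (A n) x \<partial>lborel) \<longlonglongrightarrow> (\<integral>\<^sup>+x. g x * indicator (\<Union>n. A n) x \<partial>lborel)"
    if "incseq A" "\<And>n. A n \<in> sets borel" "g \<in> borel_measurable borel"
    for A :: "nat \<Rightarrow> real set" and g :: "real \<Rightarrow> ennreal"
  proof (rule nn_integral_LIMSEQ)
    show "incseq (\<lambda>n x. g x * indicator (A n) x)"
      using that by (auto simp: incseq_def le_fun_def indicator_def intro!: mult_left_mono)
    show "(\<lambda>x. g x * indicator (A n) x) \<in> borel_measurable lborel" for n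
      using that by measurable
    show "(\<lambda>n. g x * indicator (A n) x) \<longlonglongrightarrow> g x * indicator (\<Union> (range A)) x" for x
    proof -
      have "\<forall>\<^sub>F n in sequentially. indicator (A n) x = (indicator (\<Union> (range A)) x :: ennreal)"
      proof (cases "x \<in> \<Union>(range A)")
        case True
        then obtain n where "x \<in> A n" by blast
        then have "x \<in> A m" if "m \<ge> n" for m using that \<open>incseq A\<close> by (auto simp: incseq_def)
        then show ?thesis using True by (auto simp: eventually_sequentially indicator_def)
      qed (auto simp: indicator_def)
      then show ?thesis by (auto intro!: tendsto_eventually elim: eventually_mono)
    qed
  qed
  have "(\<lambda>n. \<integral>\<^sup>+x. f x * indicator {exp (-real (Suc n))..exp (real (Suc n))} x \<partial>lborel) \<longlonglongrightarrow> (\<integral>\<^sup>+x. f x * indicator {0<..} x \<partial>lborel)"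
    using l[OF inc(2), of f] unfolding un2 by simp
  moreover have "(\<lambda>n. \<integral>\<^sup>+y. f (exp y) * ennreal (exp y) * indicator {-real (Suc n)..real (Suc n)} y \<partial>lborel)
     \<longlonglongrightarrow> (\<integral>\<^sup>+y. f (exp y) * ennreal (exp y) * indicator UNIV y \<partial>lborel)"
    using l[OF inc(1), of "\<lambda>y. f (exp y) * ennreal (exp y)"] unfolding un by simp
  ultimately show ?thesis unfolding step using LIMSEQ_unique by fastforce
qed

text \<open>
  Stated for measures, the substitution \<open>x = e\<^sup>y\<close> transfers integrability and integrals of
  complex functions at once.
\<close>
lemma density_halfline_eq_distr_exp:
  "density lborel (indicator {0::real<..}) = distr (density lborel (\<lambda>y. ennreal (exp y))) borel exp"
proof (rule measure_eqI)
  fix X assume "X \<in> sets (density lborel (indicator {0::real<..}))"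
  then have [measurable]: "X \<in> sets borel" by simp
  have [measurable]: "exp -` X \<in> sets borel"
    by (rule measurable_sets_borel[of _ borel]) measurable
  have "emeasure (density lborel (indicator {0::real<..})) X = (\<integral>\<^sup>+x. indicator X x * indicator {0::real<..} x \<partial>lborel)"
    by (subst emeasure_density) (auto simp: mult.commute intro!: borel_measurable_indicator)
  also have "\<dots> = (\<integral>\<^sup>+y. indicator X (exp y) * ennreal (exp y) \<partial>lborel)"
    by (rule nn_integral_exp_substitution) measurable
  also have "\<dots> = emeasure (distr (density lborel (\<lambda>y. ennreal (exp y))) borel exp) X"
    by (subst emeasure_distr, simp_all, subst emeasure_density)
       (auto simp: mult.commute indicator_def intro!: nn_integral_cong)
  finally show "emeasure (density lborel (indicator {0::real<..})) X = emeasure (distr (density lborel (\<lambda>y. ennreal (exp y))) borel exp) X" .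
qed simp

lemma set_integral_exp_substitution:
  fixes F :: "real \<Rightarrow> complex"
  assumes [measurable]: "F \<in> borel_measurable borel"
  shows "set_integrable lborel {0<..} F \<longleftrightarrow> integrable lborel (\<lambda>y. of_real (exp y) * F (exp y))"
    and "(LINT x:{0<..}|lborel. F x) = (LINT y|lborel. of_real (exp y) * F (exp y))"
proof -
  have i: "(indicator {0<..} :: real \<Rightarrow> ennreal) = (\<lambda>x. ennreal (indicator {0<..} x))"
    by (auto simp: indicator_def)
  have "set_integrable lborel {0<..} F \<longleftrightarrow> integrable (density lborel (indicator {0<..})) F"
    unfolding i set_integrable_def by (subst integrable_density) auto
  also have "\<dots> \<longleftrightarrow> integrable lborel (\<lambda>y. exp y *\<^sub>R F (exp y))"
    unfolding density_halfline_eq_distr_exp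
    by (subst integrable_distr_eq, simp_all, subst integrable_density) auto
  finally show "set_integrable lborel {0<..} F \<longleftrightarrow> integrable lborel (\<lambda>y. of_real (exp y) * F (exp y))"
    by (simp add: scaleR_conv_of_real)
  have "(LINT x:{0<..}|lborel. F x) = integral\<^sup>L (density lborel (indicator {0<..})) F"
    unfolding i set_lebesgue_integral_def by (subst integral_density) auto
  also have "\<dots> = (LINT y|lborel. exp y *\<^sub>R F (exp y))"
    unfolding density_halfline_eq_distr_exp
    by (subst integral_distr, simp_all, subst integral_density) auto
  finally show "(LINT x:{0<..}|lborel. F x) = (LINT y|lborel. of_real (exp y) * F (exp y))"
    by (simp add: scaleR_conv_of_real)
qed

lemma space_mult_haar: "space mult_haar = {0<..}"
  and sets_mult_haar: "sets mult_haar = sets (restrict_space borel {0<..})"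
  by (simp_all add: mult_haar_def space_restrict_space sets_restrict_space)

lemma sigma_finite_mult_haar: "sigma_finite_measure mult_haar"
proof -
  have "sigma_finite_measure (restrict_space lborel {0<..} :: real measure)"
    by (rule sigma_finite_measure_restrict_space) (auto intro: sigma_finite_lborel)
  then show ?thesis unfolding mult_haar_def
    by (subst sigma_finite_measure.sigma_finite_iff_density_finite)
       (auto intro!: measurable_restrict_space1)
qed

text \<open>
  The logarithm is an isomorphism from the multiplicative to the additive group, and \<open>du/u\<close> is
  the corresponding Haar measure.
\<close>
lemma mult_haar_ln:
  fixes H :: "real \<Rightarrow> complex"
  assumes [measurable]: "H \<in> borel_measurable borel"
  shows "integrable mult_haar (\<lambda>u. H (ln u)) \<longleftrightarrow> integrable lborel H"
    and "(LINT u|mult_haar. H (ln u)) = (LINT y|lborel. H y)"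
proof -
  have [measurable]: "(\<lambda>u. 1 / u) \<in> borel_measurable (restrict_space lborel {0<..} :: real measure)"
    "(\<lambda>u. H (ln u)) \<in> borel_measurable (restrict_space lborel {0<..} :: real measure)"
    by (auto intro!: measurable_restrict_space1)
  have ae: "AE u in restrict_space lborel {0<..}. 0 \<le> (1 / u :: real)"
    by (auto simp: AE_restrict_space_iff)
  have "integrable mult_haar (\<lambda>u. H (ln u)) \<longleftrightarrow>
      integrable (restrict_space lborel {0<..}) (\<lambda>u. (1/u) *\<^sub>R H (ln u))"
    unfolding mult_haar_def by (subst integrable_density) (auto intro: ae)
  also have "\<dots> \<longleftrightarrow> set_integrable lborel {0<..} (\<lambda>u. (1/u) *\<^sub>R H (ln u))"
    by (subst integrable_restrict_space) (auto simp: set_integrable_def)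
  also have "\<dots> \<longleftrightarrow> integrable lborel H"
    by (subst set_integral_exp_substitution) (auto simp: scaleR_conv_of_real)
  finally show "integrable mult_haar (\<lambda>u. H (ln u)) \<longleftrightarrow> integrable lborel H" .
  have "integral\<^sup>L mult_haar (\<lambda>u. H (ln u)) =
      integral\<^sup>L (restrict_space lborel {0<..}) (\<lambda>u. (1/u) *\<^sub>R H (ln u))"
    unfolding mult_haar_def by (subst integral_density) (auto intro: ae)
  also have "\<dots> = (LINT u:{0<..}|lborel. (1/u) *\<^sub>R H (ln u))"
    by (subst integral_restrict_space) (auto simp: set_lebesgue_integral_def)
  also have "\<dots> = integral\<^sup>L lborel H"
    by (subst set_integral_exp_substitution) (auto simp: scaleR_conv_of_real)
  finally show "(LINT u|mult_haar. H (ln u)) = (LINT y|lborel. H y)" .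
qed

section \<open>Fourier inversion and autocorrelation\<close>

definition fourier :: "(real \<Rightarrow> complex) \<Rightarrow> real \<Rightarrow> complex" where
  "fourier f t = (LINT y|lborel. f y * iexp (t * y))"

lemma measurable_iexp [measurable (raw)]:
  "f \<in> borel_measurable M \<Longrightarrow> (\<lambda>x. iexp (f x)) \<in> borel_measurable M"
proof -
  assume [measurable]: "f \<in> borel_measurable M"
  have "(\<lambda>x. iexp x) \<in> borel_measurable borel"
    by (intro borel_measurable_continuous_onI continuous_intros)
  then show ?thesis by measurable
qed

lemma measurable_cnj [measurable (raw)]:
  "f \<in> borel_measurable M \<Longrightarrow> (\<lambda>x. cnj (f x)) \<in> borel_measurable M"
  by (rule measurable_compose[of _ _ borel]) (auto intro!: borel_measurable_continuous_onI continuous_intros)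

lemma integrable_mult_bounded:
  fixes f g :: "'a \<Rightarrow> complex"
  assumes f: "integrable M f" and [measurable]: "g \<in> borel_measurable M" and B: "\<And>x. norm (g x) \<le> B"
  shows "integrable M (\<lambda>x. f x * g x)"
proof (rule Bochner_Integration.integrable_bound)
  have [measurable]: "f \<in> borel_measurable M" using f by (rule borel_measurable_integrable)
  show "integrable M (\<lambda>x. norm (f x) * B)" using f by (intro integrable_mult_left integrable_norm)
  show "(\<lambda>x. f x * g x) \<in> borel_measurable M" by measurable
  show "AE x in M. norm (f x * g x) \<le> norm (norm (f x) * B)"
  proof (rule AE_I2)
    fix x
    have "norm (f x * g x) \<le> norm (f x) * B"
      using B by (simp add: norm_mult mult_left_mono)
    then show "norm (f x * g x) \<le> norm (norm (f x) * B)" by simp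
  qed
qed

lemma integrable_iexp_mult: "integrable lborel f \<Longrightarrow> integrable lborel (\<lambda>y. f y * iexp (t * y))"
  for f :: "real \<Rightarrow> complex"
  by (rule integrable_mult_bounded[where B = 1]) auto

lemma (in pair_sigma_finite) integrable_tensor:
  fixes f :: "'a \<Rightarrow> complex" and g :: "'b \<Rightarrow> complex"
  assumes f: "integrable M1 f" and g: "integrable M2 g"
  shows "integrable (M1 \<Otimes>\<^sub>M M2) (\<lambda>(x, y). f x * g y)"
proof (rule Fubini_integrable)
  have [measurable]: "f \<in> borel_measurable M1" "g \<in> borel_measurable M2"
    using f g by (auto intro: borel_measurable_integrable)
  show "(\<lambda>(x, y). f x * g y) \<in> borel_measurable (M1 \<Otimes>\<^sub>M M2)" by measurable
  show "integrable M1 (\<lambda>x. LINT y|M2. norm (case (x, y) of (x, y) \<Rightarrow> f x * g y))"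
    using f by (auto simp: norm_mult)
  show "AE x in M1. integrable M2 (\<lambda>y. case (x, y) of (x, y) \<Rightarrow> f x * g y)"
    using g by auto
qed

lemma measurable_fourier [measurable]:
  assumes [measurable]: "f \<in> borel_measurable borel"
  shows "fourier f \<in> borel_measurable borel"
proof -
  have "(\<lambda>t. LINT y|lborel. f y * iexp (t * y)) \<in> borel_measurable borel" by measurable
  then show ?thesis by (simp add: fourier_def[abs_def])
qed

lemma norm_fourier_le: "norm (fourier f t) \<le> (LINT y|lborel. norm (f y))"
proof -
  have "norm (fourier f t) \<le> (LINT y|lborel. norm (f y * iexp (t * y)))"
    unfolding fourier_def by (rule integral_norm_bound)
  then show ?thesis by (simp add: norm_mult)
qed

lemma std_normal_fourier:
  "(LINT v|lborel. of_real (std_normal_density v) * iexp (s * v)) = of_real (sqrt (2 * pi) * std_normal_density s)"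
proof -
  have "char std_normal_distribution s = (LINT v|lborel. of_real (std_normal_density v) * iexp (s * v))"
    unfolding char_def by (subst integral_density) (auto simp: scaleR_conv_of_real)
  moreover have "char std_normal_distribution s = of_real (sqrt (2 * pi) * std_normal_density s)"
    unfolding char_std_normal_distribution by (simp add: std_normal_density_def)
  ultimately show ?thesis by simp
qed

text \<open>
  Insert a Gaussian factor of width \<open>n\<close> into the inverse transform. By Fubini and the
  self-duality of the Gaussian, the result is the average of \<open>a\<close> around \<open>x\<close> against a Gaussian of
  width \<open>1/n\<close>; both sides converge dominatedly as \<open>n\<close> grows.
\<close>
theorem fourier_inversion:
  fixes a :: "real \<Rightarrow> complex"
  assumes cont: "continuous_on UNIV a" and bounded: "\<And>x. norm (a x) \<le> B"
    and int: "integrable lborel a" and hat: "integrable lborel (fourier a)"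
  shows "a x = (1 / (2 * pi)) * fourier (fourier a) (- x)"
proof -
  let ?w = "\<lambda>v. complex_of_real (std_normal_density v)"
  have [measurable]: "a \<in> borel_measurable borel" using int by (auto dest: borel_measurable_integrable)
  have wint: "integrable lborel ?w"
    using integrable_normal_density[of 1 0] by simp
  have w0: "sqrt (2 * pi) * std_normal_density 0 = 1" by (simp add: std_normal_density_def)
  have wle: "sqrt (2 * pi) * std_normal_density v \<le> 1" for v by (simp add: std_normal_density_def)
  have wint1: "(LINT v|lborel. ?w v) = 1"
    using std_normal_fourier[of 0] w0 by simp
  have wcont: "isCont std_normal_density v" for v
    unfolding std_normal_density_def by (intro continuous_intros) auto
  have inner: "(LINT t|lborel. iexp (t * y) * of_real (sqrt (2 * pi) * std_normal_density (t / real (Suc n))))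
      = of_real (2 * pi * real (Suc n) * std_normal_density (real (Suc n) * y))" for n y
  proof -
    let ?N = "real (Suc n)"
    have "(LINT t|lborel. iexp (t * y) * of_real (sqrt (2 * pi) * std_normal_density (t / ?N)))
       = \<bar>?N\<bar> *\<^sub>R (LINT v|lborel. iexp ((0 + ?N * v) * y) * of_real (sqrt (2 * pi) * std_normal_density ((0 + ?N * v) / ?N)))"
      by (rule lborel_integral_real_affine) simp
    also have "\<dots> = of_real ?N * (LINT v|lborel. of_real (sqrt (2 * pi)) * (?w v * iexp (?N * y * v)))"
      by (simp add: scaleR_conv_of_real mult_ac del: of_nat_Suc)
    also have "\<dots> = of_real ?N * (of_real (sqrt (2 * pi)) * of_real (sqrt (2 * pi) * std_normal_density (?N * y)))"
      unfolding integral_mult_right_zero std_normal_fourier ..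
    also have "\<dots> = of_real (2 * pi * ?N * std_normal_density (?N * y))"
    proof -
      have "sqrt (2 * pi) * sqrt (2 * pi) = 2 * pi" by simp
      then have "?N * (sqrt (2 * pi) * (sqrt (2 * pi) * std_normal_density (?N * y))) = 2 * pi * ?N * std_normal_density (?N * y)"
        by (metis mult.assoc mult.left_commute)
      then show ?thesis by (simp only: of_real_mult[symmetric])
    qed
    finally show ?thesis .
  qed
  define L where "L = (\<lambda>n. LINT t|lborel. fourier a t * iexp (- x * t) * of_real (sqrt (2 * pi) * std_normal_density (t / real (Suc n))))"
  have Leq: "L n = of_real (2 * pi) * (LINT v|lborel. a (x + v / real (Suc n)) * ?w v)" for n
  proof -
    let ?N = "real (Suc n)"
    let ?c = "\<lambda>t. complex_of_real (sqrt (2 * pi) * std_normal_density (t / ?N))"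
    have cint: "integrable lborel ?c"
    proof -
      have "integrable lborel (\<lambda>t. ?w (0 + (1 / ?N) * t))"
        by (rule lborel_integrable_real_affine[OF wint]) simp
      then show ?thesis by simp
    qed
    have pint: "integrable (lborel \<Otimes>\<^sub>M lborel) (\<lambda>(t, y). ?c t * a y * iexp (t * (y - x)))"
    proof -
      have "integrable (lborel \<Otimes>\<^sub>M lborel) (\<lambda>p. (case p of (t, y) \<Rightarrow> ?c t * a y) * iexp (fst p * (snd p - x)))"
        by (rule integrable_mult_bounded[OF lborel_pair.integrable_tensor[OF cint int], where B = 1]) auto
      then show ?thesis by (simp only: split_beta')
    qed
    have "L n = (LINT t|lborel. (LINT y|lborel. ?c t * a y * iexp (t * (y - x))))"
    proof -
      have "fourier a t * iexp (- x * t) * ?c t = (LINT y|lborel. ?c t * a y * iexp (t * (y - x)))" for t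
      proof -
        have "?c t * a y * iexp (t * (y - x)) = (iexp (- x * t) * ?c t) * (a y * iexp (t * y))" for y
          by (simp add: exp_add[symmetric] algebra_simps)
        then have "(LINT y|lborel. ?c t * a y * iexp (t * (y - x))) = (LINT y|lborel. (iexp (- x * t) * ?c t) * (a y * iexp (t * y)))"
          by (simp only:)
        also have "\<dots> = fourier a t * iexp (- x * t) * ?c t"
          unfolding integral_mult_right_zero fourier_def by (simp only: mult_ac)
        finally show ?thesis by (rule sym)
      qed
      then show ?thesis unfolding L_def by (simp only:)
    qed
    also have "\<dots> = (LINT y|lborel. (LINT t|lborel. ?c t * a y * iexp (t * (y - x))))"
      using lborel_pair.Fubini_integral[OF pint] by simp
    also have "\<dots> = (LINT y|lborel. a y * (LINT t|lborel. iexp (t * (y - x)) * ?c t))"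
    proof -
      have "?c t * a y * iexp (t * (y - x)) = a y * (iexp (t * (y - x)) * ?c t)" for t y
        by (simp add: mult_ac)
      then show ?thesis by (simp only: integral_mult_right_zero)
    qed
    also have "\<dots> = (LINT y|lborel. a y * of_real (2 * pi * ?N * std_normal_density (?N * (y - x))))"
      unfolding inner ..
    also have "\<dots> = \<bar>1 / ?N\<bar> *\<^sub>R (LINT v|lborel. a (x + 1 / ?N * v) * of_real (2 * pi * ?N * std_normal_density (?N * (x + 1 / ?N * v - x))))"
      by (rule lborel_integral_real_affine) simp
    also have "\<dots> = \<bar>1 / ?N\<bar> *\<^sub>R (LINT v|lborel. of_real (2 * pi * ?N) * (a (x + v / ?N) * ?w v))"
      by (simp add: mult_ac del: of_nat_Suc)
    also have "\<dots> = of_real (2 * pi) * (LINT v|lborel. a (x + v / ?N) * ?w v)"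
      unfolding integral_mult_right_zero by (simp add: scaleR_conv_of_real del: of_nat_Suc)
    finally show ?thesis .
  qed
  have "(\<lambda>n. LINT v|lborel. a (x + v / real (Suc n)) * ?w v) \<longlonglongrightarrow> (LINT v|lborel. a x * ?w v)"
  proof (rule integral_dominated_convergence[where w = "\<lambda>v. B * std_normal_density v"])
    show "integrable lborel (\<lambda>v. B * std_normal_density v)" using integrable_normal_density[of 1 0] by simp
    show "AE v in lborel. (\<lambda>n. a (x + v / real (Suc n)) * ?w v) \<longlonglongrightarrow> a x * ?w v"
    proof (intro AE_I2 tendsto_intros)
      fix v :: real
      have "(\<lambda>n. x + v / real (Suc n)) \<longlonglongrightarrow> x + 0"
        using LIMSEQ_Suc[OF lim_const_over_n[of v]] by (intro tendsto_intros) auto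
      then show "(\<lambda>n. a (x + v / real (Suc n))) \<longlonglongrightarrow> a x"
        using cont by (intro isCont_tendsto_compose[of x a]) (auto simp: continuous_on_eq_continuous_at)
    qed
    show "AE v in lborel. norm (a (x + v / real (Suc n)) * ?w v) \<le> B * std_normal_density v" for n
      using bounded by (auto simp: norm_mult normal_density_nonneg intro!: mult_right_mono AE_I2)
  qed auto
  then have "L \<longlonglongrightarrow> of_real (2 * pi) * (LINT v|lborel. a x * ?w v)"
    unfolding Leq[abs_def] by (intro tendsto_mult tendsto_const)
  then have L1: "L \<longlonglongrightarrow> of_real (2 * pi) * a x"
    unfolding integral_mult_right_zero wint1 by simp
  have "L \<longlonglongrightarrow> (LINT t|lborel. fourier a t * iexp (- x * t))"
    unfolding L_def
  proof (rule integral_dominated_convergence[where w = "\<lambda>t. norm (fourier a t)"])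
    show "integrable lborel (\<lambda>t. norm (fourier a t))" using hat by simp
    show "AE t in lborel. (\<lambda>n. fourier a t * iexp (- x * t) * of_real (sqrt (2 * pi) * std_normal_density (t / real (Suc n))))
        \<longlonglongrightarrow> fourier a t * iexp (- x * t)"
    proof (rule AE_I2)
      fix t :: real
      have "(\<lambda>n. t / real (Suc n)) \<longlonglongrightarrow> 0" using LIMSEQ_Suc[OF lim_const_over_n[of t]] .
      then have "(\<lambda>n. sqrt (2 * pi) * std_normal_density (t / real (Suc n))) \<longlonglongrightarrow> sqrt (2 * pi) * std_normal_density 0"
        by (intro tendsto_intros isCont_tendsto_compose[OF wcont])
      then have "(\<lambda>n. fourier a t * iexp (- x * t) * complex_of_real (sqrt (2 * pi) * std_normal_density (t / real (Suc n))))
         \<longlonglongrightarrow> fourier a t * iexp (- x * t) * of_real 1"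
        unfolding w0 by (intro tendsto_mult tendsto_const tendsto_of_real)
      then show "(\<lambda>n. fourier a t * iexp (- x * t) * complex_of_real (sqrt (2 * pi) * std_normal_density (t / real (Suc n))))
         \<longlonglongrightarrow> fourier a t * iexp (- x * t)" by simp
    qed
    show "AE t in lborel. norm (fourier a t * iexp (- x * t) * of_real (sqrt (2 * pi) * std_normal_density (t / real (Suc n)))) \<le> norm (fourier a t)" for n
    proof (rule AE_I2)
      fix t :: real
      have "norm (complex_of_real (sqrt (2 * pi) * std_normal_density (t / real (Suc n)))) \<le> 1"
        using wle[of "t / real (Suc n)"] by (simp only: norm_of_real) (simp add: normal_density_nonneg)
      then show "norm (fourier a t * iexp (- x * t) * of_real (sqrt (2 * pi) * std_normal_density (t / real (Suc n)))) \<le> norm (fourier a t)"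
        unfolding norm_mult[of "_ * _" "of_real _"] by (simp add: norm_mult mult_left_le)
    qed
  qed auto
  from LIMSEQ_unique[OF L1 this] have "of_real (2 * pi) * a x = fourier (fourier a) (- x)"
    by (simp add: fourier_def[of "fourier a"])
  then show ?thesis by (simp add: field_simps)
qed

definition autocorr :: "(real \<Rightarrow> complex) \<Rightarrow> real \<Rightarrow> complex" where
  "autocorr g w = (LINT y|lborel. g (y + w) * cnj (g y))"

lemma autocorr_bounded:
  assumes "integrable lborel g" "\<And>y. norm (g y) \<le> B"
  shows "norm (autocorr g w) \<le> B * (LINT y|lborel. norm (g y))"
proof -
  have [measurable]: "g \<in> borel_measurable borel" using assms(1) by (auto dest: borel_measurable_integrable)
  have "integrable lborel (\<lambda>y. cnj (g y) * g (y + w))"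
    using assms by (intro integrable_mult_bounded[where B = B]) auto
  then have "integrable lborel (\<lambda>y. g (y + w) * cnj (g y))"
    by (simp only: mult.commute)
  then have "norm (autocorr g w) \<le> (LINT y|lborel. B * norm (g y))"
    unfolding autocorr_def
    by (rule Bochner_Integration.integral_norm_bound_integral)
       (use assms in \<open>auto simp: norm_mult intro!: mult_right_mono\<close>)
  then show ?thesis by simp
qed

lemma autocorr_continuous:
  assumes c: "continuous_on UNIV g" and i: "integrable lborel g" and B: "\<And>y. norm (g y) \<le> B"
  shows "continuous_on UNIV (autocorr g)"
proof -
  have [measurable]: "g \<in> borel_measurable borel" using i by (auto dest: borel_measurable_integrable)
  have "isCont (autocorr g) w" for w
    unfolding continuous_at_sequentially
  proof (intro allI impI)
    fix X :: "nat \<Rightarrow> real" assume X: "X \<longlonglongrightarrow> w"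
    show "(autocorr g \<circ> X) \<longlonglongrightarrow> autocorr g w"
      unfolding autocorr_def comp_def
    proof (rule integral_dominated_convergence[where w = "\<lambda>y. B * norm (g y)"])
      show "AE y in lborel. (\<lambda>n. g (y + X n) * cnj (g y)) \<longlonglongrightarrow> g (y + w) * cnj (g y)"
        using c X by (intro AE_I2 tendsto_intros isCont_tendsto_compose[of _ g])
          (auto simp: continuous_on_eq_continuous_at)
      show "AE y in lborel. norm (g (y + X n) * cnj (g y)) \<le> B * norm (g y)" for n
        using B by (auto simp: norm_mult intro!: mult_right_mono)
    qed (use i in auto)
  qed
  then show ?thesis by (simp add: continuous_on_eq_continuous_at)
qed

text \<open>
  The autocorrelation is the convolution of \<open>g\<close> with its reflected conjugate, whose Fourier
  transform is the conjugate of that of \<open>g\<close>.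
\<close>
lemma
  assumes i: "integrable lborel g"
  shows integrable_autocorr: "integrable lborel (autocorr g)"
    and fourier_autocorr: "fourier (autocorr g) t = of_real ((norm (fourier g t))\<^sup>2)"
proof -
  have [measurable]: "g \<in> borel_measurable borel" using i by (auto dest: borel_measurable_integrable)
  have sh: "integrable lborel (\<lambda>w. g (y + w))" for y
    using lborel_integrable_real_affine[OF i, of 1 y] by simp
  have shn: "(LINT w|lborel. norm (g (y + w))) = (LINT w|lborel. norm (g w))" for y
    using lborel_integral_real_affine[of 1 "\<lambda>w. norm (g w)" y] by simp
  have p: "integrable (lborel \<Otimes>\<^sub>M lborel) (\<lambda>(y, w). g (y + w) * cnj (g y))"
  proof (rule lborel_pair.Fubini_integrable)
    show "integrable lborel (\<lambda>y. LINT w|lborel. norm (case (y, w) of (y, w) \<Rightarrow> g (y + w) * cnj (g y)))"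
      using i by (simp add: norm_mult shn)
    show "AE y in lborel. integrable lborel (\<lambda>w. case (y, w) of (y, w) \<Rightarrow> g (y + w) * cnj (g y))"
      using sh by auto
  qed auto
  show "integrable lborel (autocorr g)"
    using lborel_pair.integrable_snd[OF p] by (simp add: autocorr_def[abs_def])
  have pt: "integrable (lborel \<Otimes>\<^sub>M lborel) (\<lambda>(y, w). g (y + w) * cnj (g y) * iexp (t * w))"
  proof -
    have "integrable (lborel \<Otimes>\<^sub>M lborel) (\<lambda>p. (case p of (y, w) \<Rightarrow> g (y + w) * cnj (g y)) * iexp (t * snd p))"
      by (rule integrable_mult_bounded[OF p, where B = 1]) auto
    then show ?thesis by (simp only: split_beta')
  qed
  have "fourier (autocorr g) t = (LINT w|lborel. (LINT y|lborel. g (y + w) * cnj (g y) * iexp (t * w)))"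
    by (simp add: fourier_def autocorr_def)
  also have "\<dots> = (LINT y|lborel. (LINT w|lborel. g (y + w) * cnj (g y) * iexp (t * w)))"
    by (rule lborel_pair.Fubini_integral[OF pt])
  also have "\<dots> = (LINT y|lborel. cnj (g y * iexp (t * y)) * fourier g t)"
  proof (rule Bochner_Integration.integral_cong[OF refl])
    fix y :: real
    have "fourier g t = (LINT w|lborel. g (y + w) * iexp (t * (y + w)))"
      using lborel_integral_real_affine[of 1 "\<lambda>w. g w * iexp (t * w)" y] by (simp add: fourier_def)
    moreover have "g (y + w) * cnj (g y) * iexp (t * w) = cnj (g y * iexp (t * y)) * (g (y + w) * iexp (t * (y + w)))" for w
    proof -
      have "cnj (iexp (t * y)) * iexp (t * (y + w)) = iexp (t * w)"
        by (simp add: exp_cnj exp_add[symmetric] algebra_simps)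
      then show ?thesis by (simp add: mult_ac)
    qed
    ultimately show "(LINT w|lborel. g (y + w) * cnj (g y) * iexp (t * w)) = cnj (g y * iexp (t * y)) * fourier g t"
      by (simp only: integral_mult_right_zero)
  qed
  also have "\<dots> = cnj (fourier g t) * fourier g t"
    unfolding integral_mult_left_zero fourier_def by (simp only: Bochner_Integration.integral_cnj)
  also have "\<dots> = of_real ((norm (fourier g t))\<^sup>2)"
    unfolding complex_norm_square by (rule mult.commute)
  finally show "fourier (autocorr g) t = of_real ((norm (fourier g t))\<^sup>2)" .
qed

section \<open>The kernel of the function A\<close>

definition phi :: "complex \<Rightarrow> complex" where
  "phi z = 1 / z - 1 / (exp z - 1)"

text \<open>
  The generating function of the Bernoulli numbers, with its removable singularity at 0 filled.
\<close>
definition bern :: "complex \<Rightarrow> complex" where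
  "bern z = (if z = 0 then 1 else z / (exp z - 1))"

lemma exp_neq_1_disc: "exp z \<noteq> 1" if "z \<noteq> 0" "norm z < 2 * pi" for z :: complex
proof
  assume "exp z = 1"
  then obtain n :: int where n: "Re z = 0" "Im z = of_int (2 * n) * pi"
    unfolding exp_eq_1 by blast
  have "norm z = \<bar>of_int (2 * n)\<bar> * pi" using n by (simp add: cmod_eq_Im abs_mult)
  with that have "\<bar>of_int n\<bar> < (1::real)" by (simp add: abs_mult)
  then have "n = 0" by linarith
  with n that show False by (simp add: complex_eq_iff)
qed

lemma exp_neq_1_Re: "exp z \<noteq> 1" if "Re z > 0" for z :: complex
proof
  assume "exp z = 1"
  then have "norm (exp z) = 1" by simp
  with that show False by simp
qed

lemma bern_holomorphic: "bern holomorphic_on ball 0 (2 * pi)"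
proof (rule no_isolated_singularity'[where K = "{0}"])
  show "(bern \<longlongrightarrow> bern z) (at z within ball 0 (2 * pi))" if "z \<in> {0}" for z
  proof -
    have "((\<lambda>z. (exp z - exp 0) / (z - 0)) \<longlongrightarrow> exp 0) (at (0::complex))"
      using DERIV_exp[of "0::complex"] unfolding has_field_derivative_iff .
    then have "((\<lambda>z. 1 / ((exp z - 1) / z)) \<longlongrightarrow> 1 / 1) (at (0::complex))"
      by (intro tendsto_intros) auto
    then have "(bern \<longlongrightarrow> 1) (at 0)"
      using Lim_transform_eventually[of "\<lambda>z. 1 / ((exp z - 1) / z)" "1/1" "at 0" bern]
      by (simp add: bern_def eventually_at_filter)
    with that show ?thesis by (auto simp: bern_def intro: tendsto_within_subset)
  qed
  show "bern holomorphic_on ball 0 (2 * pi) - {0}"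
  proof (rule holomorphic_transform)
    show "(\<lambda>z. z / (exp z - 1)) holomorphic_on ball 0 (2 * pi) - {0}"
      using exp_neq_1_disc by (intro holomorphic_intros) auto
  qed (auto simp: bern_def)
qed auto

lemma phi_eq_bern: "z \<noteq> 0 \<Longrightarrow> phi z = (1 - bern z) / z"
  by (simp add: phi_def bern_def diff_divide_distrib)

lemma phi_holomorphic: "phi holomorphic_on {z. Re z > 0}"
  unfolding phi_def using exp_neq_1_Re by (intro holomorphic_intros) auto

text \<open>
  The two poles at 0 cancel: \<open>\<phi>\<close> is, up to sign, the difference quotient of a holomorphic
  function.
\<close>
lemma phi_bounded_near_0: "\<exists>C>0. \<forall>z. z \<noteq> 0 \<and> norm z \<le> 1 \<longrightarrow> norm (phi z) \<le> C"
proof -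
  have "(\<lambda>z. if z = 0 then deriv bern 0 else (bern z - bern 0) / (z - 0)) holomorphic_on ball 0 (2 * pi)"
    by (rule pole_lemma[OF bern_holomorphic]) auto
  then have "continuous_on (cball 0 1) (\<lambda>z. if z = 0 then deriv bern 0 else (bern z - bern 0) / (z - 0))"
    using pi_gt3 by (intro holomorphic_on_imp_continuous_on, elim holomorphic_on_subset) auto
  then have "compact ((\<lambda>z. if z = 0 then deriv bern 0 else (bern z - bern 0) / (z - 0)) ` cball 0 1)"
    by (intro compact_continuous_image) auto
  then obtain C where C: "C > 0" 
    "\<And>z. z \<in> cball 0 1 \<Longrightarrow> norm (if z = 0 then deriv bern 0 else (bern z - bern 0) / (z - 0)) \<le> C"
    using compact_imp_bounded bounded_pos by (metis (no_types, lifting) imageI)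
  have "norm (phi z) \<le> C" if "z \<noteq> 0" "norm z \<le> 1" for z
    using C(2)[of z] that by (simp add: phi_eq_bern norm_divide norm_minus_commute bern_def[of 0])
  with C(1) show ?thesis by blast
qed

lemma norm_phi_le: "norm (phi z) \<le> 1 / norm z + 1 / Re z" if "Re z > 0" for z
proof -
  have "Re z \<le> exp (Re z) - 1" using exp_ge_add_one_self[of "Re z"] by linarith
  also have "\<dots> \<le> norm (exp z - 1)" using norm_triangle_ineq2[of "exp z" 1] by simp
  finally have "1 / norm (exp z - 1) \<le> 1 / Re z" using that by (intro divide_left_mono) (auto simp: exp_neq_1_Re)
  then show ?thesis unfolding phi_def
    using norm_triangle_ineq4[of "1/z" "1/(exp z - 1)"] by (simp add: norm_divide)
qed

text \<open>
  Both behaviours, bounded at 0 and \<open>O(1/x)\<close> at infinity, are captured by \<open>1/(1 + x)\<close>.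
  Uniformity for \<open>z\<close> in compact parts of the right half-plane is what makes integrals over rays
  holomorphic in the direction of the ray.
\<close>
lemma phi_bound:
  assumes "c > 0"
  shows "\<exists>D>0. \<forall>x>0. \<forall>z. c \<le> Re z \<and> norm z \<le> R \<longrightarrow> norm (phi (of_real x * z)) \<le> D / (1 + x)"
proof -
  obtain C where C: "C > 0" "\<And>z. z \<noteq> 0 \<Longrightarrow> norm z \<le> 1 \<Longrightarrow> norm (phi z) \<le> C"
    using phi_bounded_near_0 by blast
  define B where "B = C + 2 * \<bar>R\<bar> / c"
  have B: "B > 0" using C(1) assms by (simp add: B_def add_pos_nonneg)
  have "norm (phi (of_real x * z)) \<le> (B + 2 / c) / (1 + x)" if x: "x > 0" and z: "c \<le> Re z" "norm z \<le> R" for x z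
  proof -
    have z0: "Re z > 0" "z \<noteq> 0" using z assms by auto
    have nz: "Re z \<le> norm z" by (rule complex_Re_le_cmod)
    have "norm (phi (of_real x * z)) \<le> 1 / (x * norm z) + 1 / (x * Re z)"
      using norm_phi_le[of "of_real x * z"] x z0 by (simp add: norm_mult)
    also have "\<dots> \<le> 1 / (x * c) + 1 / (x * c)"
      using x z nz assms by (intro add_mono divide_left_mono mult_left_mono mult_pos_pos) auto
    finally have 1: "x * norm (phi (of_real x * z)) \<le> 2 / c"
      using x assms by (simp add: field_simps)
    have 2: "norm (phi (of_real x * z)) \<le> B"
    proof (cases "x * norm z \<le> 1")
      case True
      then have "norm (phi (of_real x * z)) \<le> C" using x z0 by (intro C(2)) (auto simp: norm_mult)
      also have "\<dots> \<le> B" using assms by (simp add: B_def)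
      finally show ?thesis .
    next
      case False
      have "1 \<le> x * R" using False z x by (smt (verit) mult_left_mono)
      then have R: "R > 0" using x by (smt (verit) zero_less_mult_iff)
      have "norm (phi (of_real x * z)) \<le> (2 / c) / x"
        using 1 x by (metis mult.commute pos_le_divide_eq)
      also have "\<dots> \<le> (2 / c) * R" using \<open>1 \<le> x * R\<close> x assms by (simp add: field_simps)
      also have "\<dots> \<le> B" using C(1) R by (simp add: B_def)
      finally show ?thesis .
    qed
    have "(1 + x) * norm (phi (of_real x * z)) \<le> B + 2 / c" using 1 2 by (simp add: algebra_simps)
    then show ?thesis using x by (simp add: field_simps)
  qed
  moreover have "B + 2 / c > 0" using B assms by (simp add: add_pos_pos)
  ultimately show ?thesis by blast
qed

section \<open>Continuation of zeta and the Mellin transform of the kernel\<close>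

definition bern_coeff :: "nat \<Rightarrow> complex" where
  "bern_coeff n = (deriv ^^ n) bern 0 / fact n"

lemma bern_sums: "norm z < 2 * pi \<Longrightarrow> (\<lambda>n. bern_coeff n * z ^ n) sums bern z"
  using holomorphic_power_series[OF bern_holomorphic, of z] by (simp add: bern_coeff_def)

lemma bern_coeff_0: "bern_coeff 0 = 1"
  by (simp add: bern_coeff_def bern_def)

lemma summable_norm_bern_coeff: "summable (\<lambda>n. norm (bern_coeff (Suc n)))"
proof -
  have "summable (\<lambda>n. bern_coeff n * 2 ^ n)"
    using bern_sums[of 2] pi_gt3 by (auto simp: sums_iff)
  from powser_insidea[OF this, of 1] have "summable (\<lambda>n. norm (bern_coeff n))" by simp
  then show ?thesis by (subst summable_Suc_iff)
qed

lemma norm_of_real_powr: "x > 0 \<Longrightarrow> norm (of_real x powr s) = x powr Re s" for x :: real and s :: complex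
  by (simp add: norm_powr_real_powr)

lemma has_vector_derivative_of_real_powr:
  fixes x :: real and s :: complex
  assumes "x > 0" "s \<noteq> 0"
  shows "((\<lambda>x. complex_of_real x powr s / s) has_vector_derivative (of_real x powr (s - 1))) (at x)"
proof -
  have "((\<lambda>z::complex. z powr s / s) has_field_derivative (of_real x powr (s - 1))) (at (complex_of_real x))"
    using assms by (auto intro!: derivative_eq_intros)
  then show ?thesis by (rule has_vector_derivative_real_field)
qed

lemma isCont_of_real_powr: "x > 0 \<Longrightarrow> isCont (\<lambda>x::real. complex_of_real x powr s) x"
  by (intro continuous_intros) auto

lemma measurable_of_real_powr [measurable]: "(\<lambda>x. complex_of_real x powr s) \<in> borel_measurable borel"
  unfolding powr_def by measurable

lemma powr_unit_interval:
  fixes s :: complex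
  assumes s: "Re s > 0"
  shows "set_integrable lborel {0<..<1} (\<lambda>x. of_real x powr (s - 1))"
    and "(LINT x:{0<..<1}|lborel. of_real x powr (s - 1)) = 1 / s"
proof -
  have e: "einterval 0 1 = {0<..<1::real}" by (simp add: einterval_eq zero_ereal_def one_ereal_def)
  have lim0: "((\<lambda>x. x powr a / a) \<longlongrightarrow> 0) (at_right 0)" if "a > 0" for a :: real
    using that by real_asymp
  have r: "set_integrable lborel (einterval 0 1) (\<lambda>x. x powr (Re s - 1))"
  proof (rule interval_integral_FTC_nonneg(1)[where F = "\<lambda>x. x powr Re s / Re s" and A = 0 and B = "1 / Re s"])
    show "((\<lambda>x. x powr Re s / Re s) has_real_derivative x powr (Re s - 1)) (at x)" if "0 < ereal x" for x
      using that s by (auto intro!: derivative_eq_intros)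
    show "isCont (\<lambda>x. x powr (Re s - 1)) x" if "0 < ereal x" for x
      using that by (auto intro!: continuous_intros)
    show "(((\<lambda>x. x powr Re s / Re s) \<circ> real_of_ereal) \<longlongrightarrow> 0) (at_right 0)"
      using lim0[OF s] by (simp add: zero_ereal_def ereal_tendsto_simps)
    have "((\<lambda>x. x powr Re s / Re s) \<longlongrightarrow> 1 powr Re s / Re s) (at_left 1)"
      using s by (intro tendsto_intros) auto
    then show "(((\<lambda>x. x powr Re s / Re s) \<circ> real_of_ereal) \<longlongrightarrow> 1 / Re s) (at_left 1)"
      by (simp add: one_ereal_def ereal_tendsto_simps)
  qed auto
  show i: "set_integrable lborel {0<..<1} (\<lambda>x. of_real x powr (s - 1))"
    by (rule set_integrable_bound[OF r[unfolded e]]) (auto simp: norm_of_real_powr set_borel_measurable_def)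
  have "(LBINT x=0..1. of_real x powr (s - 1)) = 1 / s - 0"
  proof (rule interval_integral_FTC_integrable[where F = "\<lambda>x. of_real x powr s / s"])
    show "((\<lambda>x. of_real x powr s / s) has_vector_derivative of_real x powr (s - 1)) (at x)" if "0 < ereal x" for x
      using that s by (intro has_vector_derivative_of_real_powr) auto
    show "isCont (\<lambda>x. complex_of_real x powr (s - 1)) x" if "0 < ereal x" for x
      using that by (intro isCont_of_real_powr) auto
    show "(((\<lambda>x. complex_of_real x powr s / s) \<circ> real_of_ereal) \<longlongrightarrow> 0) (at_right 0)"
    proof -
      have "((\<lambda>x. norm (complex_of_real x powr s / s)) \<longlongrightarrow> 0) (at_right 0)"
      proof (rule Lim_transform_eventually)
        have "((\<lambda>x. x powr Re s / Re s * (Re s / norm s)) \<longlongrightarrow> 0 * (Re s / norm s)) (at_right 0)"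
          by (intro tendsto_intros lim0 s)
        then show "((\<lambda>x. x powr Re s / Re s * (Re s / norm s)) \<longlongrightarrow> 0) (at_right 0)" by simp
        show "\<forall>\<^sub>F x in at_right 0. x powr Re s / Re s * (Re s / cmod s) = cmod (complex_of_real x powr s / s)"
          using s by (auto simp: eventually_at_filter norm_divide norm_of_real_powr)
      qed
      then show ?thesis by (simp add: zero_ereal_def ereal_tendsto_simps tendsto_norm_zero_iff)
    qed
    have "isCont (\<lambda>x. complex_of_real x powr s / s) 1"
      using s by (intro continuous_intros isCont_of_real_powr) auto
    then have "((\<lambda>x. complex_of_real x powr s / s) \<longlongrightarrow> 1 / s) (at_left 1)"
      by (auto simp: isCont_def intro: tendsto_within_subset)
    then show "(((\<lambda>x. complex_of_real x powr s / s) \<circ> real_of_ereal) \<longlongrightarrow> 1 / s) (at_left 1)"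
      by (simp add: one_ereal_def ereal_tendsto_simps)
    show "set_integrable lborel (einterval 0 1) (\<lambda>x. of_real x powr (s - 1))" using i e by simp
  qed auto
  then show "(LINT x:{0<..<1}|lborel. of_real x powr (s - 1)) = 1 / s"
    by (simp add: interval_lebesgue_integral_def e)
qed

lemma set_integral_Ici_eq_Ioi:
  fixes f :: "real \<Rightarrow> complex" and a :: real
  assumes [measurable]: "f \<in> borel_measurable borel"
  shows "set_integrable lborel {a..} f \<longleftrightarrow> set_integrable lborel {a<..} f"
    and "(LINT x:{a..}|lborel. f x) = (LINT x:{a<..}|lborel. f x)"
proof -
  have ae: "AE x in lborel. indicator {a..} x *\<^sub>R f x = indicator {a<..} x *\<^sub>R f x"
    using AE_lborel_singleton[of a] by eventually_elim (auto simp: indicator_def)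
  show "set_integrable lborel {a..} f \<longleftrightarrow> set_integrable lborel {a<..} f"
    unfolding set_integrable_def by (rule integrable_cong_AE[OF _ _ ae]) measurable
  show "(LINT x:{a..}|lborel. f x) = (LINT x:{a<..}|lborel. f x)"
    unfolding set_lebesgue_integral_def by (rule integral_cong_AE[OF _ _ ae]) measurable
qed

lemma powr_infinite_interval:
  fixes s :: complex
  assumes s: "Re s < 0"
  shows "set_integrable lborel {1..} (\<lambda>x. of_real x powr (s - 1))"
    and "(LINT x:{1..}|lborel. of_real x powr (s - 1)) = - (1 / s)"
proof -
  have e: "einterval 1 \<infinity> = {1::real<..}" by (simp add: einterval_eq one_ereal_def)
  have lim0: "((\<lambda>x. x powr a / a) \<longlongrightarrow> 0) at_top" if "a < 0" for a :: real
    using that by real_asymp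
  have gt: "x > 0" if "1 < ereal x" for x using that by (simp add: one_ereal_def)
  have r: "set_integrable lborel (einterval 1 \<infinity>) (\<lambda>x. x powr (Re s - 1))"
  proof (rule interval_integral_FTC_nonneg(1)[where F = "\<lambda>x. x powr Re s / Re s" and A = "1 / Re s" and B = 0])
    show "((\<lambda>x. x powr Re s / Re s) has_real_derivative x powr (Re s - 1)) (at x)" if "1 < ereal x" for x
      using gt[OF that] s by (auto intro!: derivative_eq_intros)
    show "isCont (\<lambda>x. x powr (Re s - 1)) x" if "1 < ereal x" for x
      using gt[OF that] by (auto intro!: continuous_intros)
    show "(((\<lambda>x. x powr Re s / Re s) \<circ> real_of_ereal) \<longlongrightarrow> 0) (at_left \<infinity>)"
      using lim0[OF s] by (simp add: ereal_tendsto_simps)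
    have "((\<lambda>x. x powr Re s / Re s) \<longlongrightarrow> 1 powr Re s / Re s) (at_right 1)"
      using s by (intro tendsto_intros) auto
    then show "(((\<lambda>x. x powr Re s / Re s) \<circ> real_of_ereal) \<longlongrightarrow> 1 / Re s) (at_right 1)"
      by (simp add: one_ereal_def ereal_tendsto_simps)
  qed auto
  have i: "set_integrable lborel {1<..} (\<lambda>x. of_real x powr (s - 1))"
    by (rule set_integrable_bound[OF r[unfolded e]]) (auto simp: norm_of_real_powr set_borel_measurable_def)
  then show "set_integrable lborel {1..} (\<lambda>x. of_real x powr (s - 1))"
    by (subst set_integral_Ici_eq_Ioi) auto
  have "(LBINT x=1..\<infinity>. of_real x powr (s - 1)) = 0 - 1 / s"
  proof (rule interval_integral_FTC_integrable[where F = "\<lambda>x. of_real x powr s / s"])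
    show "((\<lambda>x. of_real x powr s / s) has_vector_derivative of_real x powr (s - 1)) (at x)" if "1 < ereal x" for x
      using gt[OF that] s by (intro has_vector_derivative_of_real_powr) auto
    show "isCont (\<lambda>x. complex_of_real x powr (s - 1)) x" if "1 < ereal x" for x
      using gt[OF that] by (intro isCont_of_real_powr) auto
    show "(((\<lambda>x. complex_of_real x powr s / s) \<circ> real_of_ereal) \<longlongrightarrow> 0) (at_left \<infinity>)"
    proof -
      have "((\<lambda>x. norm (complex_of_real x powr s / s)) \<longlongrightarrow> 0) at_top"
      proof (rule Lim_transform_eventually)
        have "((\<lambda>x. x powr Re s / Re s * (Re s / norm s)) \<longlongrightarrow> 0 * (Re s / norm s)) at_top"
          by (intro tendsto_intros lim0 s)
        then show "((\<lambda>x. x powr Re s / Re s * (Re s / norm s)) \<longlongrightarrow> 0) at_top" by simp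
        show "\<forall>\<^sub>F x in at_top. x powr Re s / Re s * (Re s / cmod s) = cmod (complex_of_real x powr s / s)"
          using eventually_gt_at_top[of 0] by eventually_elim (use s in \<open>auto simp: norm_divide norm_of_real_powr\<close>)
      qed
      then show ?thesis by (simp add: ereal_tendsto_simps tendsto_norm_zero_iff)
    qed
    have "isCont (\<lambda>x. complex_of_real x powr s / s) 1"
      using s by (intro continuous_intros isCont_of_real_powr) auto
    then have "((\<lambda>x. complex_of_real x powr s / s) \<longlongrightarrow> 1 / s) (at_right 1)"
      by (auto simp: isCont_def intro: tendsto_within_subset)
    then show "(((\<lambda>x. complex_of_real x powr s / s) \<circ> real_of_ereal) \<longlongrightarrow> 1 / s) (at_right 1)"
      by (simp add: one_ereal_def ereal_tendsto_simps)
    show "set_integrable lborel (einterval 1 \<infinity>) (\<lambda>x. of_real x powr (s - 1))" using i e by simp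
  qed auto
  then show "(LINT x:{1..}|lborel. of_real x powr (s - 1)) = - (1 / s)"
    by (subst set_integral_Ici_eq_Ioi) (auto simp: interval_lebesgue_integral_def e)
qed

lemma of_real_powr_minus_1: "x > 0 \<Longrightarrow> of_real x powr (s - 1) = of_real x powr s / (of_real x :: complex)"
  by (simp add: powr_diff)

text \<open>
  On \<open>(0, 1)\<close> the power series of \<open>x/(e\<^sup>x - 1)\<close> converges absolutely, since its radius of
  convergence is \<open>2\<pi>\<close>, so it may be integrated term by term. Removing the constant term moves the
  abscissa of convergence from 1 to 0.
\<close>
lemma bern_mellin:
  fixes s :: complex
  assumes s: "Re s > 0"
  shows "set_integrable lborel {0<..<1} (\<lambda>x. (bern (of_real x) - 1) * of_real x powr (s - 2))"
    and "(\<lambda>n. bern_coeff (Suc n) / (s + of_nat n)) sums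
          (LINT x:{0<..<1}|lborel. (bern (of_real x) - 1) * of_real x powr (s - 2))"
proof -
  define f where "f = (\<lambda>n x. indicator {0<..<1} x *\<^sub>R (bern_coeff (Suc n) * of_real x powr (s + of_nat n - 1)))"
  have int: "integrable lborel (f n)" for n
    using set_integrable_mult_right[OF powr_unit_interval(1)[of "s + of_nat n"], of "bern_coeff (Suc n)"] s
    by (auto simp: f_def set_integrable_def)
  have val: "integral\<^sup>L lborel (f n) = bern_coeff (Suc n) / (s + of_nat n)" for n
  proof -
    have "integral\<^sup>L lborel (f n) = (LINT x:{0<..<1}|lborel. bern_coeff (Suc n) * of_real x powr (s + of_nat n - 1))"
      unfolding f_def set_lebesgue_integral_def ..
    also have "\<dots> = bern_coeff (Suc n) * (LINT x:{0<..<1}|lborel. of_real x powr (s + of_nat n - 1))"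
      by (rule set_integral_mult_right)
    also have "\<dots> = bern_coeff (Suc n) / (s + of_nat n)"
      using powr_unit_interval(2)[of "s + of_nat n"] s by simp
    finally show ?thesis .
  qed
  have nf: "norm (f n x) \<le> norm (bern_coeff (Suc n)) * (indicator {0<..<1} x * x powr (Re s - 1))" for n x
    by (auto simp: f_def indicator_def norm_mult norm_of_real_powr intro!: mult_left_mono powr_mono')
  have r: "integrable lborel (\<lambda>x. indicator {0<..<1} x * x powr (Re s - 1))"
    using integrable_norm[OF powr_unit_interval(1)[OF s, unfolded set_integrable_def]]
    by (rule integrable_eq)
       (auto simp: indicator_def norm_of_real_powr)
  have S1: "summable (\<lambda>n. norm (f n x))" for x
    by (rule summable_comparison_test'[OF summable_mult2[OF summable_norm_bern_coeff, of "indicator {0<..<1} x * x powr (Re s - 1)"]])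
       (use nf in auto)
  have S2: "summable (\<lambda>n. LINT x|lborel. norm (f n x))"
  proof (rule summable_comparison_test'[OF summable_mult2[OF summable_norm_bern_coeff, of "LINT x|lborel. indicator {0<..<1} x * x powr (Re s - 1)"]])
    fix n
    have "(LINT x|lborel. norm (f n x)) \<le> (LINT x|lborel. norm (bern_coeff (Suc n)) * (indicator {0<..<1} x * x powr (Re s - 1)))"
      using int r nf by (intro integral_mono) auto
    also have "\<dots> = norm (bern_coeff (Suc n)) * (LINT x|lborel. indicator {0<..<1} x * x powr (Re s - 1))"
      using r by simp
    finally show "norm (LINT x|lborel. norm (f n x)) \<le> \<dots>" by (simp add: integral_nonneg_AE)
  qed
  have sm: "(\<Sum>n. f n x) = indicator {0<..<1} x *\<^sub>R ((bern (of_real x) - 1) * of_real x powr (s - 2))" for x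
  proof (cases "x \<in> {0<..<1}")
    case True
    have "(\<lambda>n. bern_coeff n * of_real x ^ n) sums bern (of_real x)"
      using True pi_gt3 by (intro bern_sums) auto
    then have "(\<lambda>n. bern_coeff (Suc n) * of_real x ^ Suc n) sums (bern (of_real x) - 1)"
      by (subst sums_Suc_iff) (simp add: bern_coeff_0)
    then have "(\<lambda>n. bern_coeff (Suc n) * of_real x ^ Suc n * of_real x powr (s - 2)) sums ((bern (of_real x) - 1) * of_real x powr (s - 2))"
      by (rule sums_mult2)
    moreover have "bern_coeff (Suc n) * of_real x ^ Suc n * of_real x powr (s - 2) = f n x" for n
    proof -
      have "complex_of_real x ^ Suc n * of_real x powr (s - 2) = of_real x powr (of_nat (Suc n)) * of_real x powr (s - 2)"
        using True by (subst powr_nat') auto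
      also have "\<dots> = of_real x powr (s + of_nat n - 1)"
        using True by (subst powr_add[symmetric]) (auto simp: algebra_simps)
      finally show ?thesis using True by (simp add: f_def mult.assoc)
    qed
    ultimately show ?thesis using True by (simp add: sums_iff)
  qed (auto simp: f_def)
  show "set_integrable lborel {0<..<1} (\<lambda>x. (bern (of_real x) - 1) * of_real x powr (s - 2))"
    unfolding set_integrable_def sm[symmetric] by (rule integrable_suminf[OF int _ S2]) (use S1 in auto)
  show "(\<lambda>n. bern_coeff (Suc n) / (s + of_nat n)) sums
          (LINT x:{0<..<1}|lborel. (bern (of_real x) - 1) * of_real x powr (s - 2))"
    unfolding set_lebesgue_integral_def sm[symmetric] val[symmetric]
    by (rule sums_integral[OF int _ S2]) (use S1 in auto)
qed

text \<open>
  The part over \<open>[1, \<infinity>)\<close> of the integral for \<open>\<Gamma>(s) \<zeta>(s)\<close>. It converges for every \<open>s\<close>, so it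
  is entire.
\<close>
definition zeta_tail :: "complex \<Rightarrow> complex" where
  "zeta_tail s = (LINT x:{1..}|lborel. of_real x powr (s - 1) / (exp (of_real x) - 1))"

lemma set_integrable_Gamma:
  assumes "Re s > 0"
  shows "set_integrable lborel {0<..} (\<lambda>x. complex_of_real x powr (s - 1) * of_real (exp (- x)))"
    and "(LINT x:{0<..}|lborel. complex_of_real x powr (s - 1) * of_real (exp (- x))) = Gamma s"
proof -
  have e: "complex_of_real x powr (s - 1) * of_real (exp (- x)) = complex_of_real x powr (s - 1) / of_real (exp x)" for x
    by (simp add: exp_minus field_simps)
  have "set_integrable lebesgue {0<..} (\<lambda>x. complex_of_real x powr (s - 1) / of_real (exp x))"
    using absolutely_integrable_Gamma_integral'[OF assms] .
  then show i: "set_integrable lborel {0<..} (\<lambda>x. complex_of_real x powr (s - 1) * of_real (exp (- x)))"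
    unfolding e set_integrable_def by (subst (asm) integrable_completion) auto
  show "(LINT x:{0<..}|lborel. complex_of_real x powr (s - 1) * of_real (exp (- x))) = Gamma s"
    using set_borel_integral_eq_integral(2)[OF i] Gamma_integral_complex'[OF assms] unfolding e
    by (simp add: integral_unique)
qed

lemma norm_exp_minus_1_ge: "exp x - 1 \<le> norm (exp (complex_of_real x) - 1)"
  using norm_triangle_ineq2[of "exp (complex_of_real x)" 1] by simp

lemma zeta_tail_bound:
  fixes R x :: real and s :: complex
  assumes "x \<ge> 1" "Re s - 1 \<le> R - 1"
  shows "norm (complex_of_real x powr (s - 1) / (exp (of_real x) - 1)) \<le> 2 * (x powr (R - 1) * exp (- x))"
proof -
  have "2 \<le> exp x" using exp_ge_add_one_self[of x] assms by linarith
  then have "exp x / 2 \<le> exp x - 1" by simp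
  also have "\<dots> \<le> norm (exp (complex_of_real x) - 1)" by (rule norm_exp_minus_1_ge)
  finally have "x powr (Re s - 1) / norm (exp (complex_of_real x) - 1) \<le> x powr (R - 1) / (exp x / 2)"
    using assms by (intro frac_le powr_mono) auto
  then show ?thesis using assms by (simp add: norm_divide norm_of_real_powr exp_minus field_simps)
qed

lemma zeta_tail_dominator:
  fixes R :: real
  assumes "R > 0"
  shows "integrable lborel (\<lambda>x. indicator {1..} x * (2 * (x powr (R - 1) * exp (- x))))"
proof -
  have "set_integrable lborel {0<..} (\<lambda>x. complex_of_real x powr (of_real R - 1) * of_real (exp (- x)))"
    using assms by (intro set_integrable_Gamma) auto
  then have "set_integrable lborel {1..} (\<lambda>x. complex_of_real x powr (of_real R - 1) * of_real (exp (- x)))"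
    by (rule set_integrable_subset) auto
  then have "integrable lborel (\<lambda>x. norm (indicator {1..} x *\<^sub>R (complex_of_real x powr (of_real R - 1) * of_real (exp (- x)))))"
    unfolding set_integrable_def by (rule integrable_norm)
  then have "integrable lborel (\<lambda>x. 2 * norm (indicator {1..} x *\<^sub>R (complex_of_real x powr (of_real R - 1) * of_real (exp (- x)))))"
    by (rule integrable_mult_right)
  then show ?thesis
    by (rule integrable_eq)
       (auto simp: indicator_def norm_mult norm_of_real_powr)
qed

lemma zeta_tail_integrable:
  fixes s :: complex
  shows
  "set_integrable lborel {1..} (\<lambda>x. of_real x powr (s - 1) / (exp (of_real x) - 1))"
  unfolding set_integrable_def
proof (rule Bochner_Integration.integrable_bound[OF zeta_tail_dominator[of "\<bar>Re s\<bar> + 1"]])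
  show "AE x in lborel. norm (indicator {1..} x *\<^sub>R (of_real x powr (s - 1) / (exp (complex_of_real x) - 1)))
     \<le> norm (indicator {1..} x * (2 * (x powr (\<bar>Re s\<bar> + 1 - 1) * exp (- x))))"
    using zeta_tail_bound[of _ s "\<bar>Re s\<bar> + 1"] by (intro AE_I2) (auto simp: indicator_def)
qed auto

lemma zeta_tail_holomorphic: "zeta_tail holomorphic_on A"
proof -
  have "(\<lambda>s. LINT x|lborel. indicator {1..} x *\<^sub>R (of_real x powr (s - 1) / (exp (of_real x) - 1))) holomorphic_on UNIV"
  proof (rule holomorphic_on_parametric_integral)
    fix x :: real
    show "(\<lambda>s. indicator {1..} x *\<^sub>R (of_real x powr (s - 1) / (exp (of_real x) - 1))) holomorphic_on UNIV"
      by (cases "x \<ge> 1") (auto simp: indicator_def powr_def divide_inverse intro!: holomorphic_intros)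
  next
    fix s :: complex
    let ?R = "\<bar>Re s\<bar> + 2"
    show "\<exists>r>0. \<exists>w. integrable lborel w \<and> cball s r \<subseteq> UNIV \<and> (\<forall>x\<in>space lborel. \<forall>y\<in>cball s r.
        norm (indicator {1..} x *\<^sub>R (of_real x powr (y - 1) / (exp (of_real x) - 1))) \<le> w x)"
    proof (intro exI[of _ 1] conjI exI[of _ "\<lambda>x. indicator {1..} x * (2 * (x powr (?R - 1) * exp (- x)))"] ballI)
      fix x :: real and y assume "y \<in> cball s 1"
      then have "\<bar>Re (s - y)\<bar> \<le> 1" using abs_Re_le_cmod[of "s - y"] by (simp add: dist_norm)
      then have "Re y - 1 \<le> ?R - 1" by simp
      then show "norm (indicator {1..} x *\<^sub>R (of_real x powr (y - 1) / (exp (of_real x) - 1)))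
          \<le> indicator {1..} x * (2 * (x powr (?R - 1) * exp (- x)))"
        using zeta_tail_bound[of x y ?R] by (auto simp: indicator_def)
    qed (use zeta_tail_dominator[of ?R] in auto)
  qed auto
  then show ?thesis
    unfolding zeta_tail_def set_lebesgue_integral_def by (rule holomorphic_on_subset) auto
qed

text \<open>
  Expand \<open>1/(e\<^sup>x - 1)\<close> as a geometric series and rescale each term to Euler's integral.
\<close>
lemma Gamma_Dirichlet_series:
  assumes s: "Re s > 1"
  shows "set_integrable lborel {0<..} (\<lambda>x. of_real x powr (s - 1) / (exp (of_real x) - 1))"
    and "Gamma s * (\<Sum>n. 1 / of_nat (Suc n) powr s) =
           (LINT x:{0<..}|lborel. of_real x powr (s - 1) / (exp (of_real x) - 1))"
proof -
  define f where "f = (\<lambda>n x. indicator {0<..} x *\<^sub>R (complex_of_real x powr (s - 1) * of_real (exp (- (real (Suc n) * x)))))"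
  define g where "g = (\<lambda>n x. indicator {0<..} x *\<^sub>R (complex_of_real x powr (of_real (Re s) - 1) * of_real (exp (- (real (Suc n) * x)))))"
  have scale: "integrable lborel (\<lambda>x. indicator {0<..} x *\<^sub>R (complex_of_real x powr (z - 1) * of_real (exp (- (real (Suc n) * x)))))
      \<and> (LINT x|lborel. indicator {0<..} x *\<^sub>R (complex_of_real x powr (z - 1) * of_real (exp (- (real (Suc n) * x))))) = Gamma z / of_nat (Suc n) powr z"
    if z: "Re z > 0" for n z
  proof -
    let ?F = "\<lambda>x. indicator {0<..} x *\<^sub>R (complex_of_real x powr (z - 1) * of_real (exp (- x)))"
    let ?H = "\<lambda>x. indicator {0<..} x *\<^sub>R (complex_of_real x powr (z - 1) * of_real (exp (- (real (Suc n) * x))))"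
    have F: "integrable lborel ?F" "integral\<^sup>L lborel ?F = Gamma z"
      using set_integrable_Gamma[OF z] by (auto simp: set_integrable_def set_lebesgue_integral_def)
    have eq: "?F (0 + real (Suc n) * x) = of_nat (Suc n) powr (z - 1) * ?H x" for x
    proof (cases "x > 0")
      case True
      have "complex_of_real (real (Suc n) * x) powr (z - 1) = of_real (real (Suc n)) powr (z - 1) * of_real x powr (z - 1)"
        unfolding of_real_mult using True by (intro powr_times_real) auto
      then show ?thesis using True by (simp add: indicator_def)
    qed (auto simp: indicator_def zero_less_mult_iff)
    have nz: "of_nat (Suc n) powr z \<noteq> (0::complex)" by (simp del: of_nat_Suc)
    have nz1: "of_nat (Suc n) powr (z - 1) \<noteq> (0::complex)" by (simp del: of_nat_Suc)
    have "integrable lborel (\<lambda>x. of_nat (Suc n) powr (z - 1) * ?H x)"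
      unfolding eq[symmetric] by (rule lborel_integrable_real_affine[OF F(1)]) simp
    then have "integrable lborel (\<lambda>x. inverse (of_nat (Suc n) powr (z - 1)) * (of_nat (Suc n) powr (z - 1) * ?H x))"
      by (rule integrable_mult_right)
    then have i: "integrable lborel ?H"
    proof (rule integrable_eq)
      fix x
      show "inverse (of_nat (Suc n) powr (z - 1)) * (of_nat (Suc n) powr (z - 1) * ?H x) = ?H x"
        unfolding mult.assoc[symmetric, of "inverse _"] using nz1 by (simp only: left_inverse mult_1_left not_False_eq_True)
    qed
    have "Gamma z = \<bar>real (Suc n)\<bar> *\<^sub>R (LINT x|lborel. ?F (0 + real (Suc n) * x))"
      using lborel_integral_real_affine[of "real (Suc n)" ?F 0] F by simp
    also have "\<dots> = of_nat (Suc n) * (of_nat (Suc n) powr (z - 1) * (LINT x|lborel. ?H x))"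
      unfolding eq integral_mult_right_zero by (simp only: scaleR_conv_of_real) simp
    also have "\<dots> = of_nat (Suc n) powr z * (LINT x|lborel. ?H x)"
      by (simp add: powr_diff del: of_nat_Suc)
    finally have "(LINT x|lborel. ?H x) = Gamma z / of_nat (Suc n) powr z"
      using nz by (simp add: field_simps del: of_nat_Suc)
    with i show ?thesis by blast
  qed
  have s0: "Re s > 0" using s by simp
  have int: "integrable lborel (f n)" and val: "integral\<^sup>L lborel (f n) = Gamma s / of_nat (Suc n) powr s" for n
    using scale[OF s0, of n] unfolding f_def by auto
  have nfg: "of_real (norm (f n x)) = g n x" for n x
    by (auto simp: f_def g_def indicator_def norm_mult norm_of_real_powr powr_of_real[symmetric])
  have valn: "(LINT x|lborel. norm (f n x)) = Re (Gamma (of_real (Re s))) / real (Suc n) powr Re s" for n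
  proof -
    have "complex_of_real (LINT x|lborel. norm (f n x)) = integral\<^sup>L lborel (g n)"
      unfolding nfg[symmetric] by simp
    also have "\<dots> = Gamma (of_real (Re s)) / of_nat (Suc n) powr (of_real (Re s))"
      using scale[of "of_real (Re s)" n] s0 unfolding g_def by auto
    also have "\<dots> = of_real (Gamma (Re s) / real (Suc n) powr Re s)"
      using powr_of_real[of "real (Suc n)" "Re s"] by (simp add: Gamma_complex_of_real)
    finally show ?thesis by (simp only: of_real_eq_iff) (simp add: Gamma_complex_of_real)
  qed
  have S2: "summable (\<lambda>n. LINT x|lborel. norm (f n x))"
  proof -
    have "summable (\<lambda>n. real n powr - Re s)" using s by (subst summable_real_powr_iff) simp
    then have "summable (\<lambda>n. real (Suc n) powr - Re s)" by (subst summable_Suc_iff)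
    then have "summable (\<lambda>n. Re (Gamma (of_real (Re s))) * real (Suc n) powr - Re s)" by (rule summable_mult)
    then show ?thesis unfolding valn by (simp add: powr_minus field_simps)
  qed
  have sm: "(\<lambda>n. f n x) sums (indicator {0<..} x *\<^sub>R (of_real x powr (s - 1) / (exp (of_real x) - 1))) \<and> summable (\<lambda>n. norm (f n x))" for x
  proof (cases "x > 0")
    case True
    have nq: "norm (complex_of_real (exp (- x))) < 1" using True by simp
    have "(\<lambda>n. complex_of_real (exp (- x)) ^ n) sums (1 / (1 - of_real (exp (- x))))"
      using nq by (rule geometric_sums)
    then have "(\<lambda>n. of_real x powr (s - 1) * of_real (exp (- x)) * complex_of_real (exp (- x)) ^ n) sums
        (of_real x powr (s - 1) * of_real (exp (- x)) * (1 / (1 - of_real (exp (- x)))))"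
      by (rule sums_mult)
    moreover have "of_real x powr (s - 1) * of_real (exp (- x)) * complex_of_real (exp (- x)) ^ n = f n x" for n
    proof -
      have "exp (- (real (Suc n) * x)) = exp (- x) * exp (- x) ^ n"
        by (simp add: exp_of_nat_mult[symmetric] exp_add[symmetric] algebra_simps)
      then show ?thesis using True by (simp add: f_def)
    qed
    moreover have "of_real x powr (s - 1) * of_real (exp (- x)) * (1 / (1 - of_real (exp (- x)))) = of_real x powr (s - 1) / (exp (complex_of_real x) - 1)"
    proof -
      have "exp (complex_of_real x) \<noteq> 1" using True by (intro exp_neq_1_Re) simp
      then show ?thesis by (simp add: exp_of_real exp_minus divide_simps) 
    qed
    ultimately have 1: "(\<lambda>n. f n x) sums (of_real x powr (s - 1) / (exp (of_real x) - 1))"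
      by (simp only:)
    have "summable (\<lambda>n. norm (of_real x powr (s - 1) * of_real (exp (- x))) * norm (complex_of_real (exp (- x))) ^ n)"
      using nq by (intro summable_mult summable_geometric) simp
    then have "summable (\<lambda>n. norm (of_real x powr (s - 1) * of_real (exp (- x)) * complex_of_real (exp (- x)) ^ n))"
      by (simp only: norm_mult norm_power)
    with 1 True show ?thesis
      using \<open>\<And>n. of_real x powr (s - 1) * of_real (exp (- x)) * complex_of_real (exp (- x)) ^ n = f n x\<close> by simp
  qed (auto simp: f_def)
  have sm': "(\<Sum>n. f n x) = indicator {0<..} x *\<^sub>R (of_real x powr (s - 1) / (exp (of_real x) - 1))" for x
    using sm[of x] by (simp add: sums_iff)
  show "set_integrable lborel {0<..} (\<lambda>x. of_real x powr (s - 1) / (exp (of_real x) - 1))"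
    unfolding set_integrable_def sm'[symmetric] by (rule integrable_suminf[OF int _ S2]) (use sm in auto)
  have S: "(\<lambda>n. Gamma s / of_nat (Suc n) powr s) sums (LINT x:{0<..}|lborel. of_real x powr (s - 1) / (exp (of_real x) - 1))"
    unfolding set_lebesgue_integral_def sm'[symmetric] val[symmetric]
    by (rule sums_integral[OF int _ S2]) (use sm in auto)
  have "Gamma s \<noteq> 0" using s0 by (auto simp: Gamma_eq_zero_iff elim!: nonpos_Ints_cases)
  then have "(\<lambda>n. 1 / of_nat (Suc n) powr s) sums ((LINT x:{0<..}|lborel. of_real x powr (s - 1) / (exp (of_real x) - 1)) / Gamma s)"
    using sums_divide[OF S, of "Gamma s"] by simp
  then show "Gamma s * (\<Sum>n. 1 / of_nat (Suc n) powr s) =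
           (LINT x:{0<..}|lborel. of_real x powr (s - 1) / (exp (of_real x) - 1))"
    using \<open>Gamma s \<noteq> 0\<close> by (simp add: sums_iff del: of_nat_Suc)
qed

text \<open>
  This is \<open>1/(\<Gamma>(s) (s + n))\<close>. The zero of \<open>1/\<Gamma>\<close> at \<open>-n\<close> cancels the pole, and the product form
  makes this visible without a case distinction.
\<close>
definition zeta_entire_summand :: "nat \<Rightarrow> complex \<Rightarrow> complex" where
  "zeta_entire_summand n s = pochhammer s n * rGamma (s + of_nat (Suc n))"

lemma zeta_entire_summand: "zeta_entire_summand n s * (s + of_nat n) = rGamma s"
  using pochhammer_rGamma[of s "Suc n"] by (simp add: zeta_entire_summand_def pochhammer_Suc mult_ac)

lemma zeta_entire_summand_eq: "s + of_nat n \<noteq> 0 \<Longrightarrow> zeta_entire_summand n s = rGamma s / (s + of_nat n)"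
  using zeta_entire_summand[of n s] by (simp add: field_simps)

lemma zeta_entire_summand_holomorphic: "zeta_entire_summand n holomorphic_on A"
  unfolding zeta_entire_summand_def pochhammer_prod by (intro holomorphic_intros)

definition zeta_head :: "complex \<Rightarrow> complex" where
  "zeta_head s = (\<Sum>n. bern_coeff (Suc n) * zeta_entire_summand n s)"

text \<open>
  On a bounded set \<open>\<bar>s + n\<bar> \<ge> 1\<close> for all large \<open>n\<close>, so the absolutely summable coefficients
  dominate the series from some index on.
\<close>
lemma zeta_head_holomorphic: "zeta_head holomorphic_on UNIV"
proof (rule holomorphic_uniform_sequence)
  show "(\<lambda>s. \<Sum>n<N. bern_coeff (Suc n) * zeta_entire_summand n s) holomorphic_on UNIV" for N
    by (intro holomorphic_intros zeta_entire_summand_holomorphic)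
  fix z :: complex
  have "compact (rGamma ` cball z 1)"
    by (intro compact_continuous_image holomorphic_on_imp_continuous_on holomorphic_rGamma) auto
  then obtain C where C: "C > 0" "\<And>s. s \<in> cball z 1 \<Longrightarrow> norm (rGamma s) \<le> C"
    using compact_imp_bounded bounded_pos by (metis imageI)
  have "uniform_limit (cball z 1) (\<lambda>N s. \<Sum>n<N. bern_coeff (Suc n) * zeta_entire_summand n s) zeta_head sequentially"
    unfolding zeta_head_def
  proof (rule Weierstrass_m_test_ev)
    show "summable (\<lambda>n. norm (bern_coeff (Suc n)) * C)"
      by (intro summable_mult2 summable_norm_bern_coeff)
    show "\<forall>\<^sub>F n in sequentially. \<forall>s\<in>cball z 1. norm (bern_coeff (Suc n) * zeta_entire_summand n s) \<le> norm (bern_coeff (Suc n)) * C"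
    proof -
      obtain N where N: "norm z + 2 \<le> real N" using real_arch_simple by blast
      have "norm (bern_coeff (Suc n) * zeta_entire_summand n s) \<le> norm (bern_coeff (Suc n)) * C"
        if n: "n \<ge> N" and s: "s \<in> cball z 1" for n s
      proof -
        have "norm s \<le> norm z + 1"
          using s norm_triangle_ineq2[of s z] by (simp add: dist_norm norm_minus_commute)
        moreover have "real n \<le> norm (s + of_nat n) + norm s"
          using norm_triangle_ineq4[of "s + of_nat n" s] by simp
        ultimately have 1: "1 \<le> norm (s + of_nat n)" using N n by linarith
        then have "norm (zeta_entire_summand n s) = norm (rGamma s) / norm (s + of_nat n)"
          by (subst zeta_entire_summand_eq) (auto simp: norm_divide)
        also have "\<dots> \<le> C / 1" using 1 C s by (intro frac_le) auto
        finally show ?thesis by (auto simp: norm_mult intro: mult_left_mono)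
      qed
      then show ?thesis unfolding eventually_sequentially by blast
    qed
  qed
  then show "\<exists>d>0. cball z d \<subseteq> UNIV \<and> uniform_limit (cball z d) (\<lambda>N s. \<Sum>n<N. bern_coeff (Suc n) * zeta_entire_summand n s) zeta_head sequentially"
    by (intro exI[of _ 1]) auto
qed auto

lemma zeta_head_eq:
  assumes "Re s > 0"
  shows "zeta_head s = rGamma s * (LINT x:{0<..<1}|lborel. (bern (of_real x) - 1) * of_real x powr (s - 2))"
proof -
  have "s + of_nat n \<noteq> 0" for n using assms by (auto simp: complex_eq_iff)
  then have "(\<lambda>n. bern_coeff (Suc n) * zeta_entire_summand n s) = (\<lambda>n. rGamma s * (bern_coeff (Suc n) / (s + of_nat n)))"
    by (auto simp: zeta_entire_summand_eq)
  then show ?thesis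
    using sums_mult[OF bern_mellin(2)[OF assms], of "rGamma s"] by (simp add: zeta_head_def sums_iff)
qed

lemma Gamma_rGamma: "Re s > 0 \<Longrightarrow> Gamma s * rGamma s = 1" for s :: complex
proof -
  assume "Re s > 0"
  then have "rGamma s \<noteq> 0" by (auto simp: rGamma_eq_zero_iff elim!: nonpos_Ints_cases)
  then show ?thesis by (simp add: Gamma_def)
qed

lemma set_integral_halfline_split:
  fixes f :: "real \<Rightarrow> complex"
  assumes "set_integrable lborel {0<..<1} f" "set_integrable lborel {1..} f"
  shows "set_integrable lborel {0<..} f"
    and "(LINT x:{0<..}|lborel. f x) = (LINT x:{0<..<1}|lborel. f x) + (LINT x:{1..}|lborel. f x)"
proof -
  have e: "{0<..} = {0<..<1} \<union> {1::real..}" by auto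
  show "set_integrable lborel {0<..} f" unfolding e by (rule set_integrable_Un[OF assms]) auto
  show "(LINT x:{0<..}|lborel. f x) = (LINT x:{0<..<1}|lborel. f x) + (LINT x:{1..}|lborel. f x)"
    unfolding e by (rule set_integral_Un[OF _ assms]) auto
qed

text \<open>
  For \<open>Re s > 1\<close> the integral for \<open>\<Gamma>(s) \<zeta>(s)\<close> is split at 1, and on \<open>(0, 1)\<close> the leading term
  \<open>x\<^bsup>s-2\<^esup>\<close> is integrated separately to \<open>1/(s - 1)\<close>. The resulting expression makes sense for all
  \<open>s \<noteq> 1\<close>.
\<close>
lemma zeta_eq:
  "zeta = (\<lambda>s. if s = 1 then 0 else rGamma s * (zeta_tail s + 1 / (s - 1)) + zeta_head s)"
  unfolding zeta_def
proof (rule analytic_continuation_eqI)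
  show "open {s. 1 < Re s}" by (rule open_halfspace_Re_gt)
  show "{s. 1 < Re s} \<noteq> {}" by (auto intro!: exI[of _ 2])
  show "{s. 1 < Re s} \<subseteq> - {1}" by auto
  show "open (- {1::complex})" by auto
  show "connected (- {1::complex})" by (rule connected_punctured_universe) simp
  have "(\<lambda>s. rGamma s * (zeta_tail s + 1 / (s - 1)) + zeta_head s) holomorphic_on - {1}"
    by (intro holomorphic_intros zeta_tail_holomorphic holomorphic_on_subset[OF zeta_head_holomorphic]) auto
  then show "(\<lambda>s. if s = 1 then 0 else rGamma s * (zeta_tail s + 1 / (s - 1)) + zeta_head s) holomorphic_on - {1}"
    by (rule holomorphic_transform) auto
  show "(if s = 1 then 0 else rGamma s * (zeta_tail s + 1 / (s - 1)) + zeta_head s) = (\<Sum>n. 1 / of_nat (Suc n) powr s)"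
    if "s \<in> {s. 1 < Re s}" for s
  proof -
    have s: "Re s > 1" "Re s > 0" "Re (s - 1) > 0" "s \<noteq> 1" using that by auto
    let ?f = "\<lambda>x. complex_of_real x powr (s - 1) / (exp (of_real x) - 1)"
    have f: "?f x = (bern (of_real x) - 1) * of_real x powr (s - 2) + of_real x powr (s - 1 - 1)" if "x > 0" for x
    proof -
      have "of_real x powr (s - 1) = of_real x powr (s - 2) * complex_of_real x"
        using that powr_add[of "complex_of_real x" "s - 2" 1] by simp
      then show ?thesis using that by (simp add: bern_def algebra_simps)
    qed
    have 1: "(LINT x:{0<..<1}|lborel. ?f x) = (LINT x:{0<..<1}|lborel. (bern (of_real x) - 1) * of_real x powr (s - 2)) + 1 / (s - 1)"
    proof -
      have "(LINT x:{0<..<1}|lborel. ?f x) = (LINT x:{0<..<1}|lborel. (bern (of_real x) - 1) * of_real x powr (s - 2) + of_real x powr (s - 1 - 1))"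
        using f by (intro set_lebesgue_integral_cong) auto
      also have "\<dots> = (LINT x:{0<..<1}|lborel. (bern (of_real x) - 1) * of_real x powr (s - 2)) + 1 / (s - 1)"
        by (subst set_integral_add(2)[OF bern_mellin(1)[OF s(2)] powr_unit_interval(1)[OF s(3)]])
           (use powr_unit_interval(2)[OF s(3)] in simp)
      finally show ?thesis .
    qed
    have "(LINT x:{0<..}|lborel. ?f x) = (LINT x:{0<..<1}|lborel. ?f x) + zeta_tail s"
      unfolding zeta_tail_def
      by (rule set_integral_halfline_split)
         (auto intro: zeta_tail_integrable set_integrable_subset[OF Gamma_Dirichlet_series(1)[OF s(1)]])
    then have "Gamma s * (\<Sum>n. 1 / of_nat (Suc n) powr s) =
        (LINT x:{0<..<1}|lborel. (bern (of_real x) - 1) * of_real x powr (s - 2)) + 1 / (s - 1) + zeta_tail s"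
      unfolding Gamma_Dirichlet_series(2)[OF s(1)] 1 .
    then have "rGamma s * (Gamma s * (\<Sum>n. 1 / of_nat (Suc n) powr s)) = rGamma s * (zeta_tail s + 1 / (s - 1)) + zeta_head s"
      unfolding zeta_head_eq[OF s(2)] by (simp add: algebra_simps)
    then show ?thesis using s Gamma_rGamma[OF s(2)] by (simp add: mult.assoc[symmetric] mult.commute)
  qed
qed auto

text \<open>
  For \<open>0 < Re s < 1\<close> the term \<open>1/(s - 1)\<close> of the continuation is itself an integral,
  \<open>-\<integral> x\<^bsup>s-2\<^esup> dx\<close> over \<open>[1, \<infinity>)\<close>, and with it the pieces reassemble to the integral of \<open>-\<phi>\<close> over the
  whole half-line.
\<close>
lemma phi_mellin:
  assumes s: "0 < Re s" "Re s < 1"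
  shows "(LINT x:{0<..}|lborel. phi (of_real x) * of_real x powr (s - 1)) = - (Gamma s * zeta s)"
proof -
  let ?f = "\<lambda>x. phi (complex_of_real x) * of_real x powr (s - 1)"
  have s1: "Re (s - 1) < 0" "s \<noteq> 1" using s by auto
  have A: "?f x = - ((bern (of_real x) - 1) * of_real x powr (s - 2))" if "x > 0" for x
  proof -
    have "of_real x powr (s - 1) = of_real x powr (s - 2) * complex_of_real x"
      using that powr_add[of "complex_of_real x" "s - 2" 1] by simp
    moreover have "phi (of_real x) * complex_of_real x = 1 - bern (of_real x)"
      using that by (simp add: phi_eq_bern)
    ultimately have "?f x = of_real x powr (s - 2) * (1 - bern (of_real x))"
      by (metis mult.assoc mult.commute)
    then show ?thesis by (simp add: algebra_simps)
  qed
  have B: "?f x = of_real x powr (s - 1 - 1) - of_real x powr (s - 1) / (exp (of_real x) - 1)" if "x > 0" for x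
    unfolding of_real_powr_minus_1[OF that, of "s - 1"] by (simp add: phi_def algebra_simps)
  have iA: "set_integrable lborel {0<..<1} ?f"
    using bern_mellin(1)[OF s(1)] A
    by (subst set_integrable_cong[OF refl refl, of _ _ "\<lambda>x. - ((bern (of_real x) - 1) * of_real x powr (s - 2))"])
       (auto simp: set_integrable_def)
  have iB: "set_integrable lborel {1..} ?f"
    using set_integral_diff(1)[OF powr_infinite_interval(1)[OF s1(1)] zeta_tail_integrable[of s]] B
    by (subst set_integrable_cong[OF refl refl]) auto
  have "(LINT x:{0<..<1}|lborel. ?f x) = (LINT x:{0<..<1}|lborel. - ((bern (of_real x) - 1) * of_real x powr (s - 2)))"
    using A by (intro set_lebesgue_integral_cong) auto
  also have "\<dots> = - (LINT x:{0<..<1}|lborel. (bern (of_real x) - 1) * of_real x powr (s - 2))"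
    by (simp add: set_lebesgue_integral_def)
  finally have vA: "rGamma s * (LINT x:{0<..<1}|lborel. ?f x) = - zeta_head s"
    using s by (simp add: zeta_head_eq)
  have "(LINT x:{1..}|lborel. ?f x) = (LINT x:{1..}|lborel. of_real x powr (s - 1 - 1) - of_real x powr (s - 1) / (exp (of_real x) - 1))"
    using B by (intro set_lebesgue_integral_cong) auto
  also have "\<dots> = - (1 / (s - 1)) - zeta_tail s"
    by (subst set_integral_diff(2)[OF powr_infinite_interval(1)[OF s1(1)] zeta_tail_integrable[of s]])
       (use powr_infinite_interval(2)[OF s1(1)] in \<open>simp add: zeta_tail_def\<close>)
  finally have vB: "(LINT x:{1..}|lborel. ?f x) = - (1 / (s - 1)) - zeta_tail s" .
  have "rGamma s * (LINT x:{0<..}|lborel. ?f x) = - zeta s"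
    using s1 by (simp add: set_integral_halfline_split(2)[OF iA iB] distrib_left vA vB zeta_eq algebra_simps)
  then have "Gamma s * (rGamma s * (LINT x:{0<..}|lborel. ?f x)) = - (Gamma s * zeta s)" by simp
  then show ?thesis using Gamma_rGamma[OF s(1)] by (simp add: mult.assoc[symmetric])
qed

section \<open>The kernel along rays\<close>

lemma measurable_phi [measurable]: "phi \<in> borel_measurable borel"
  unfolding phi_def[abs_def] by measurable

text \<open>
  The restriction of \<open>\<phi>\<close> to the ray of argument \<open>\<beta>\<close> in logarithmic coordinates. The factor
  \<open>e\<^bsup>y/2\<^esup>\<close> places its Fourier transform on the critical line.
\<close>
definition ray :: "real \<Rightarrow> real \<Rightarrow> complex" where
  "ray \<beta> y = of_real (exp (y / 2)) * phi (of_real (exp y) * cis \<beta>)"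

lemma exp_half_bound: "exp (y / 2) / (1 + exp y) \<le> exp (- (1/2 * \<bar>y\<bar>))" for y :: real
proof (cases "y \<ge> 0")
  case True
  have "exp (y / 2) = exp (- (1/2 * \<bar>y\<bar>)) * exp y" using True by (simp add: exp_add[symmetric])
  also have "\<dots> \<le> exp (- (1/2 * \<bar>y\<bar>)) * (1 + exp y)" by (intro mult_left_mono) auto
  finally show ?thesis by (simp add: divide_le_eq add_pos_pos)
next
  case False
  have "exp (y / 2) = exp (- (1/2 * \<bar>y\<bar>)) * 1" using False by simp
  also have "\<dots> \<le> exp (- (1/2 * \<bar>y\<bar>)) * (1 + exp y)" by (intro mult_left_mono) auto
  finally show ?thesis by (simp add: divide_le_eq add_pos_pos)
qed

lemma phi_exp_bound:
  assumes "c > 0"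
  shows "\<exists>D>0. \<forall>y z. c \<le> Re z \<and> norm z \<le> R \<longrightarrow>
           exp (y / 2) * norm (phi (of_real (exp y) * z)) \<le> D * exp (- (1/2 * \<bar>y\<bar>))"
proof -
  obtain D where D: "D > 0" "\<And>x z. x > 0 \<Longrightarrow> c \<le> Re z \<Longrightarrow> norm z \<le> R \<Longrightarrow> norm (phi (of_real x * z)) \<le> D / (1 + x)"
    using phi_bound[OF assms, of R] by blast
  have "exp (y / 2) * norm (phi (of_real (exp y) * z)) \<le> D * exp (- (1/2 * \<bar>y\<bar>))"
    if "c \<le> Re z" "norm z \<le> R" for y z
  proof -
    have "exp (y / 2) * norm (phi (of_real (exp y) * z)) \<le> exp (y / 2) * (D / (1 + exp y))"
      using D(2)[of "exp y" z] that by (intro mult_left_mono) auto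
    also have "\<dots> = D * (exp (y / 2) / (1 + exp y))" by simp
    also have "\<dots> \<le> D * exp (- (1/2 * \<bar>y\<bar>))" using D(1) by (intro mult_left_mono exp_half_bound) auto
    finally show ?thesis .
  qed
  with D(1) show ?thesis by blast
qed

text \<open>
  The local domination that lets integrals over a ray be differentiated in its direction.
\<close>
lemma phi_exp_bound_cball:
  assumes z: "Re z > 0"
  shows "\<exists>r>0. \<exists>D>0. cball z r \<subseteq> {z. Re z > 0} \<and> (\<forall>y. \<forall>u\<in>cball z r.
           exp (y / 2) * norm (phi (of_real (exp y) * u)) \<le> D * exp (- (1/2 * \<bar>y\<bar>)))"
proof -
  define r where "r = Re z / 2"
  have r: "r > 0" using z by (simp add: r_def)
  from phi_exp_bound[OF r, of "norm z + r"] obtain D where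
    D: "D > 0" "\<And>y u. r \<le> Re u \<Longrightarrow> norm u \<le> norm z + r \<Longrightarrow>
           exp (y / 2) * norm (phi (of_real (exp y) * u)) \<le> D * exp (- (1/2 * \<bar>y\<bar>))"
    by blast
  have u: "r \<le> Re u \<and> norm u \<le> norm z + r" if "u \<in> cball z r" for u
  proof -
    have "norm (z - u) \<le> r" using that by (simp add: dist_norm)
    moreover have "Re z - Re u \<le> norm (z - u)" using complex_Re_le_cmod[of "z - u"] by simp
    moreover have "norm u \<le> norm z + norm (z - u)" using norm_triangle_ineq4[of z "z - u"] by simp
    ultimately show ?thesis unfolding r_def by linarith
  qed
  have "cball z r \<subseteq> {z. Re z > 0}" using u r by (auto intro: less_le_trans)
  with r D u show ?thesis by (intro exI[of _ r] exI[of _ D]) auto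
qed

lemma ray_bound:
  assumes "\<bar>\<beta>\<bar> < pi / 2"
  shows "\<exists>D>0. \<forall>y. norm (ray \<beta> y) \<le> D * exp (- (1/2 * \<bar>y\<bar>))"
proof -
  have "cos \<beta> > 0" using assms by (intro cos_gt_zero_pi) auto
  from phi_exp_bound[OF this, of 1] obtain D where
    "D > 0" "\<And>y z. cos \<beta> \<le> Re z \<Longrightarrow> norm z \<le> 1 \<Longrightarrow>
           exp (y / 2) * norm (phi (of_real (exp y) * z)) \<le> D * exp (- (1/2 * \<bar>y\<bar>))"
    by blast
  then show ?thesis by (intro exI[of _ D]) (auto simp: ray_def norm_mult)
qed

lemma ray_bounded: "\<bar>\<beta>\<bar> < pi / 2 \<Longrightarrow> \<exists>B. \<forall>y. norm (ray \<beta> y) \<le> B"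
proof -
  assume "\<bar>\<beta>\<bar> < pi / 2"
  then obtain D where D: "D > 0" "\<And>y. norm (ray \<beta> y) \<le> D * exp (- (1/2 * \<bar>y\<bar>))" using ray_bound by blast
  have "norm (ray \<beta> y) \<le> D" for y
  proof -
    have "D * exp (- (1/2 * \<bar>y\<bar>)) \<le> D * 1" using D(1) by (intro mult_left_mono) auto
    with D(2)[of y] show ?thesis by linarith
  qed
  then show ?thesis by blast
qed

lemma measurable_ray [measurable]: "ray \<beta> \<in> borel_measurable borel"
  unfolding ray_def[abs_def] by measurable

lemma integrable_ray: "\<bar>\<beta>\<bar> < pi / 2 \<Longrightarrow> integrable lborel (ray \<beta>)"
proof -
  assume "\<bar>\<beta>\<bar> < pi / 2"
  then obtain D where D: "D > 0" "\<And>y. norm (ray \<beta> y) \<le> D * exp (- (1/2 * \<bar>y\<bar>))" using ray_bound by blast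
  show ?thesis
  proof (rule Bochner_Integration.integrable_bound)
    show "integrable lborel (\<lambda>y. D * exp (- (1/2 * \<bar>y\<bar>)))"
      by (intro integrable_mult_right integrable_exp_minus_abs) auto
  qed (use D in auto)
qed

lemma continuous_ray: "\<bar>\<beta>\<bar> < pi / 2 \<Longrightarrow> continuous_on UNIV (ray \<beta>)"
proof -
  assume "\<bar>\<beta>\<bar> < pi / 2"
  then have "cos \<beta> > 0" by (intro cos_gt_zero_pi) auto
  then show ?thesis
    unfolding ray_def
    by (intro continuous_intros continuous_on_compose2[OF holomorphic_on_imp_continuous_on[OF phi_holomorphic]])
       auto
qed

text \<open>
  The Mellin transform of \<open>x \<mapsto> \<phi>(xz)\<close> at \<open>1/2 + it\<close>, as a function of the direction \<open>z\<close>.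
\<close>
definition mellin_phi :: "real \<Rightarrow> complex \<Rightarrow> complex" where
  "mellin_phi t z = (LINT y|lborel. of_real (exp (y / 2)) * phi (of_real (exp y) * z) * iexp (t * y))"

lemma mellin_phi_holomorphic: "mellin_phi t holomorphic_on {z. Re z > 0}"
  unfolding mellin_phi_def
proof (rule holomorphic_on_parametric_integral)
  show "open {z. Re z > 0}" by (rule open_halfspace_Re_gt)
  fix y :: real
  have "(\<lambda>z. phi (of_real (exp y) * z)) holomorphic_on {z. Re z > 0}"
    by (rule holomorphic_on_compose_gen[OF _ phi_holomorphic, unfolded comp_def]) (auto intro!: holomorphic_intros)
  then show "(\<lambda>z. of_real (exp (y / 2)) * phi (of_real (exp y) * z) * iexp (t * y)) holomorphic_on {z. Re z > 0}"
    by (intro holomorphic_intros)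
next
  fix z :: complex assume "z \<in> {z. Re z > 0}"
  then have "Re z > 0" by simp
  from phi_exp_bound_cball[OF this] obtain r D where "r > 0" "cball z r \<subseteq> {z. Re z > 0}"
    and D: "\<And>y u. u \<in> cball z r \<Longrightarrow>
        exp (y / 2) * norm (phi (of_real (exp y) * u)) \<le> D * exp (- (1/2 * \<bar>y\<bar>))"
    by blast
  then show "\<exists>r>0. \<exists>w. integrable lborel w \<and> cball z r \<subseteq> {z. Re z > 0} \<and>
      (\<forall>y\<in>space lborel. \<forall>u\<in>cball z r. norm (of_real (exp (y / 2)) * phi (of_real (exp y) * u) * iexp (t * y)) \<le> w y)"
    by (intro exI[of _ r] exI[of _ "\<lambda>y. D * exp (- (1/2 * \<bar>y\<bar>))"] conjI
          integrable_mult_right integrable_exp_minus_abs) (auto simp: norm_mult)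
qed measurable

lemma mellin_phi_scale_real:
  assumes "x > 0"
  shows "mellin_phi t (of_real x) * of_real x powr (1/2 + \<i> * of_real t) = mellin_phi t 1"
proof -
  have x: "x = exp (ln x)" using assms by simp
  let ?F = "\<lambda>y. of_real (exp (y / 2)) * phi (of_real (exp y)) * iexp (t * y)"
  have P: "complex_of_real x powr (1/2 + \<i> * of_real t) = of_real (exp (ln x / 2)) * iexp (t * ln x)"
    using assms by (simp add: powr_def Ln_of_real exp_of_real[symmetric] exp_add[symmetric] algebra_simps del: exp_of_real)
  have "mellin_phi t 1 = (LINT y|lborel. ?F (ln x + 1 * y))"
    using lborel_integral_real_affine[of 1 ?F "ln x"] by (simp add: mellin_phi_def)
  also have "\<dots> = (LINT y|lborel. (of_real (exp (y / 2)) * phi (of_real (exp y) * of_real x) * iexp (t * y)) * (of_real (exp (ln x / 2)) * iexp (t * ln x)))"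
  proof (rule Bochner_Integration.integral_cong[OF refl])
    fix y :: real
    have "exp ((ln x + 1 * y) / 2) = exp (y / 2) * exp (ln x / 2)" by (simp add: exp_add[symmetric] add_divide_distrib add.commute)
    moreover have "exp (ln x + 1 * y) = exp y * x" using assms by (simp add: exp_add)
    moreover have "iexp (t * (ln x + 1 * y)) = iexp (t * y) * iexp (t * ln x)"
      by (simp add: exp_add[symmetric] algebra_simps)
    ultimately show "?F (ln x + 1 * y) = (of_real (exp (y / 2)) * phi (of_real (exp y) * of_real x) * iexp (t * y)) * (of_real (exp (ln x / 2)) * iexp (t * ln x))"
      by (simp only: of_real_mult mult_ac)
  qed
  also have "\<dots> = mellin_phi t (of_real x) * (of_real (exp (ln x / 2)) * iexp (t * ln x))"
    unfolding integral_mult_left_zero mellin_phi_def ..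
  finally show ?thesis unfolding P by (rule sym)
qed

lemma one_islimpt_positive_reals: "(1::complex) islimpt of_real ` {0<..}"
  unfolding islimpt_approachable
proof (intro allI impI)
  fix e :: real assume "e > 0"
  moreover have "complex_of_real (1 + e / 2) - 1 = of_real (e / 2)" by simp
  then have "norm (complex_of_real (1 + e / 2) - 1) = \<bar>e / 2\<bar>" by (simp only: norm_of_real)
  ultimately show "\<exists>x'\<in>of_real ` {0<..}. x' \<noteq> (1::complex) \<and> dist x' 1 < e"
    by (intro bexI[of _ "of_real (1 + e / 2)"] conjI) (auto simp: dist_norm complex_eq_iff simp del: of_real_add)
qed

text \<open>
  Rotation of the path of integration, without contours: for real \<open>z\<close> the identity is the
  substitution \<open>x \<mapsto> x/z\<close>, and both sides are holomorphic in \<open>z\<close>.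
\<close>
lemma mellin_phi_scale:
  assumes "Re z > 0"
  shows "mellin_phi t z * z powr (1/2 + \<i> * of_real t) = mellin_phi t 1"
proof -
  have "(mellin_phi t z * z powr (1/2 + \<i> * of_real t)) - mellin_phi t 1 = 0"
  proof (rule analytic_continuation[where S = "{z. Re z > 0}" and U = "of_real ` {0<..}" and \<xi> = 1
      and f = "\<lambda>z. mellin_phi t z * z powr (1/2 + \<i> * of_real t) - mellin_phi t 1"])
    show "(\<lambda>z. mellin_phi t z * z powr (1/2 + \<i> * of_real t) - mellin_phi t 1) holomorphic_on {z. Re z > 0}"
      by (intro holomorphic_intros mellin_phi_holomorphic) (auto simp: complex_nonpos_Reals_iff)
    show "open {z. Re z > 0}" by (rule open_halfspace_Re_gt)
    show "connected {z. Re z > 0}" by (rule convex_connected[OF convex_halfspace_Re_gt])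
    show "of_real ` {0<..} \<subseteq> {z. 0 < Re z}" by auto
    show "(1::complex) islimpt of_real ` {0<..}" by (rule one_islimpt_positive_reals)
  qed (use assms mellin_phi_scale_real in auto)
  then show ?thesis by simp
qed

lemma fourier_ray_eq_mellin_phi: "fourier (ray \<beta>) t = mellin_phi t (cis \<beta>)"
  by (simp add: fourier_def ray_def mellin_phi_def)

lemma fourier_ray:
  assumes "\<bar>\<beta>\<bar> < pi / 2"
  shows "fourier (ray \<beta>) t = exp (- (\<i> * of_real (\<beta> / 2))) * of_real (exp (\<beta> * t)) * fourier (ray 0) t"
proof -
  have c: "Re (cis \<beta>) > 0" using assms by (auto intro!: cos_gt_zero_pi)
  have L: "Ln (cis \<beta>) = \<i> * of_real \<beta>"
    unfolding cis_conv_exp using assms pi_gt_zero by (intro Ln_exp) auto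
  have "cis \<beta> powr (1/2 + \<i> * of_real t) = exp (\<i> * of_real (\<beta> / 2)) * of_real (exp (- (\<beta> * t)))"
    by (simp add: powr_def L exp_of_real[symmetric] exp_add[symmetric] algebra_simps del: exp_of_real)
  then have "fourier (ray 0) t = fourier (ray \<beta>) t * (exp (\<i> * of_real (\<beta> / 2)) * of_real (exp (- (\<beta> * t))))"
    using mellin_phi_scale[OF c, of t] by (simp add: fourier_ray_eq_mellin_phi)
  then show ?thesis
    by (simp add: exp_minus exp_of_real[symmetric] field_simps del: exp_of_real)
qed

lemma norm_fourier_ray:
  assumes "\<bar>\<beta>\<bar> < pi / 2"
  shows "norm (fourier (ray \<beta>) t) = exp (\<beta> * t) * norm (fourier (ray 0) t)"
  using fourier_ray[OF assms, of t] by (simp add: norm_mult)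

text \<open>
  Rotating towards \<open>\<theta>\<close> for \<open>t \<ge> 0\<close> and towards \<open>-\<theta>\<close> for \<open>t < 0\<close> gains the factor
  \<open>e\<^bsup>-\<theta>\<bar>t\<bar>\<^esup>\<close>, because the transforms along both rays are bounded.
\<close>
lemma norm_fourier_ray_decay:
  assumes "0 \<le> \<theta>" "\<theta> < pi / 2"
  shows "\<exists>C>0. \<forall>t. norm (fourier (ray 0) t) \<le> C * exp (- (\<theta> * \<bar>t\<bar>))"
proof -
  define C where "C = 1 + (LINT y|lborel. norm (ray \<theta> y)) + (LINT y|lborel. norm (ray (- \<theta>) y))"
  have nn: "0 \<le> (LINT y|lborel. norm (ray \<theta> y))" "0 \<le> (LINT y|lborel. norm (ray (- \<theta>) y))"
    by auto
  have "norm (fourier (ray 0) t) \<le> C * exp (- (\<theta> * \<bar>t\<bar>))" for t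
  proof -
    have "exp (\<theta> * \<bar>t\<bar>) * norm (fourier (ray 0) t) \<le> C"
    proof (cases "t \<ge> 0")
      case True
      then have "exp (\<theta> * \<bar>t\<bar>) * norm (fourier (ray 0) t) = norm (fourier (ray \<theta>) t)"
        using norm_fourier_ray[of \<theta> t] assms by simp
      with norm_fourier_le[of "ray \<theta>" t] nn show ?thesis unfolding C_def by linarith
    next
      case False
      then have "exp (\<theta> * \<bar>t\<bar>) * norm (fourier (ray 0) t) = norm (fourier (ray (- \<theta>)) t)"
        using norm_fourier_ray[of "- \<theta>" t] assms by simp
      with norm_fourier_le[of "ray (- \<theta>)" t] nn show ?thesis unfolding C_def by linarith
    qed
    then show ?thesis by (simp add: exp_minus field_simps)
  qed
  moreover have "C > 0" using nn by (simp add: C_def add_pos_nonneg)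
  ultimately show ?thesis by blast
qed

lemma fourier_ray_0_zeta:
  "fourier (ray 0) t = - (Gamma (1/2 + \<i> * of_real t) * zeta (1/2 + \<i> * of_real t))"
proof -
  let ?s = "1/2 + \<i> * complex_of_real t"
  have "fourier (ray 0) t = (LINT y|lborel. of_real (exp y) * (phi (of_real (exp y)) * of_real (exp y) powr (?s - 1)))"
    unfolding fourier_def
  proof (rule Bochner_Integration.integral_cong[OF refl])
    fix y :: real
    have "complex_of_real (exp y) * of_real (exp y) powr (?s - 1) = of_real (exp (y / 2)) * iexp (t * y)"
      by (simp add: powr_def Ln_of_real exp_of_real[symmetric] exp_add[symmetric] algebra_simps del: exp_of_real)
    then show "ray 0 y * iexp (t * y) = of_real (exp y) * (phi (of_real (exp y)) * of_real (exp y) powr (?s - 1))"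
      by (simp add: ray_def mult_ac)
  qed
  also have "\<dots> = (LINT x:{0<..}|lborel. phi (of_real x) * of_real x powr (?s - 1))"
    by (rule set_integral_exp_substitution(2)[symmetric]) measurable
  also have "\<dots> = - (Gamma ?s * zeta ?s)" by (rule phi_mellin) auto
  finally show ?thesis .
qed

text \<open>
  On the critical line \<open>1 - s\<close> is the conjugate of \<open>s\<close>, so this is the reflection formula.
\<close>
lemma norm_Gamma_critical_line:
  "(norm (Gamma (1/2 + \<i> * of_real t)))\<^sup>2 = pi / cosh (pi * t)"
proof -
  let ?s = "1/2 + \<i> * complex_of_real t"
  have "complex_of_real ((norm (Gamma ?s))\<^sup>2) = Gamma ?s * cnj (Gamma ?s)"
    by (rule complex_norm_square)
  also have "\<dots> = Gamma ?s * Gamma (1 - ?s)"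
    by (simp add: cnj_Gamma)
  also have "\<dots> = of_real pi / sin (of_real pi * ?s)"
    by (rule Gamma_reflection_complex)
  also have "sin (of_real pi * ?s) = cos (\<i> * of_real (pi * t))"
    using sin_add[of "of_real pi / 2" "\<i> * of_real (pi * t)"] by (simp add: algebra_simps)
  also have "\<dots> = of_real (cosh (pi * t))"
    by (simp add: cos_i_times cosh_field_def exp_of_real[symmetric] exp_minus del: exp_of_real)
  finally have "complex_of_real ((norm (Gamma ?s))\<^sup>2) = of_real (pi / cosh (pi * t))" by simp
  then show ?thesis by (simp only: of_real_eq_iff)
qed

lemma norm_fourier_ray_sq:
  assumes "\<bar>\<beta>\<bar> < pi / 2"
  shows "(norm (fourier (ray \<beta>) t))\<^sup>2 =
    pi * ((norm (zeta (1/2 + \<i> * of_real t)))\<^sup>2 * exp (2 * \<beta> * t) / cosh (pi * t))"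
  unfolding norm_fourier_ray[OF assms] fourier_ray_0_zeta
  by (simp add: power_mult_distrib norm_mult norm_Gamma_critical_line exp_double[symmetric] mult.assoc)

lemma cnj_ray_0: "cnj (ray 0 y) = ray 0 y"
  by (simp add: ray_def phi_def exp_of_real)

lemma cnj_fourier_ray_0: "cnj (fourier (ray 0) t) = fourier (ray 0) (- t)"
proof -
  have "cnj (fourier (ray 0) t) = (LINT y|lborel. cnj (ray 0 y * iexp (t * y)))"
    unfolding fourier_def by (rule Bochner_Integration.integral_cnj[symmetric])
  also have "\<dots> = (LINT y|lborel. ray 0 y * iexp (- t * y))"
    by (simp add: cnj_ray_0 exp_cnj)
  finally show ?thesis by (simp add: fourier_def)
qed

lemma norm_fourier_ray_uminus:
  assumes "\<bar>\<beta>\<bar> < pi / 2"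
  shows "norm (fourier (ray (- \<beta>)) (- t)) = norm (fourier (ray \<beta>) t)"
proof -
  have "norm (fourier (ray 0) (- t)) = norm (fourier (ray 0) t)"
    unfolding cnj_fourier_ray_0[symmetric] by (rule complex_mod_cnj)
  then show ?thesis using norm_fourier_ray[of \<beta> t] norm_fourier_ray[of "- \<beta>" "- t"] assms by simp
qed

text \<open>
  The decay at rate \<open>\<theta>\<close>, chosen strictly between \<open>\<bar>\<beta>\<bar>\<close> and \<open>\<pi>/2\<close>, beats the growth
  \<open>e\<^bsup>\<beta>t\<^esup>\<close> caused by the rotation.
\<close>
lemma norm_fourier_ray_sq_decay:
  assumes "\<bar>\<beta>\<bar> < pi / 2"
  shows "\<exists>C>0. \<exists>c>0. \<forall>t. (norm (fourier (ray \<beta>) t))\<^sup>2 \<le> C * exp (- (c * \<bar>t\<bar>))"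
proof -
  define \<theta> where "\<theta> = (\<bar>\<beta>\<bar> + pi / 2) / 2"
  obtain C where C: "C > 0" "\<And>t. norm (fourier (ray 0) t) \<le> C * exp (- (\<theta> * \<bar>t\<bar>))"
  proof -
    have "0 \<le> \<theta>" "\<theta> < pi / 2" using assms by (auto simp: \<theta>_def)
    from norm_fourier_ray_decay[OF this] show ?thesis using that by blast
  qed
  have "(norm (fourier (ray \<beta>) t))\<^sup>2 \<le> C\<^sup>2 * exp (- (2 * (\<theta> - \<bar>\<beta>\<bar>) * \<bar>t\<bar>))" for t
  proof -
    have "norm (fourier (ray \<beta>) t) \<le> exp (\<bar>\<beta>\<bar> * \<bar>t\<bar>) * (C * exp (- (\<theta> * \<bar>t\<bar>)))"
      unfolding norm_fourier_ray[OF assms]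
      using C(2)[of t] abs_ge_self[of "\<beta> * t"] by (intro mult_mono) (auto simp: abs_mult)
    also have "\<dots> = C * exp (- ((\<theta> - \<bar>\<beta>\<bar>) * \<bar>t\<bar>))"
      by (simp add: exp_add[symmetric] algebra_simps)
    finally have "(norm (fourier (ray \<beta>) t))\<^sup>2 \<le> (C * exp (- ((\<theta> - \<bar>\<beta>\<bar>) * \<bar>t\<bar>)))\<^sup>2"
      by (intro power_mono) auto
    also have "\<dots> = C\<^sup>2 * exp (- (2 * (\<theta> - \<bar>\<beta>\<bar>) * \<bar>t\<bar>))"
      by (simp add: power_mult_distrib exp_double[symmetric] algebra_simps)
    finally show ?thesis .
  qed
  moreover have "C\<^sup>2 > 0" "2 * (\<theta> - \<bar>\<beta>\<bar>) > 0" using C(1) assms by (auto simp: \<theta>_def)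
  ultimately show ?thesis by blast
qed

lemma integrable_norm_fourier_ray_power:
  assumes "\<bar>\<beta>\<bar> < pi / 2" "k \<ge> 1"
  shows "integrable lborel (\<lambda>t. ((norm (fourier (ray \<beta>) t))\<^sup>2) ^ k)"
proof -
  obtain C c where C: "C > 0" "c > 0" "\<And>t. (norm (fourier (ray \<beta>) t))\<^sup>2 \<le> C * exp (- (c * \<bar>t\<bar>))"
    using norm_fourier_ray_sq_decay[OF assms(1)] by blast
  show ?thesis
  proof (rule Bochner_Integration.integrable_bound)
    show "integrable lborel (\<lambda>t. C ^ k * exp (- (real k * c * \<bar>t\<bar>)))"
      using C assms(2) by (intro integrable_mult_right integrable_exp_minus_abs) auto
    show "AE t in lborel. norm (((norm (fourier (ray \<beta>) t))\<^sup>2) ^ k) \<le> norm (C ^ k * exp (- (real k * c * \<bar>t\<bar>)))"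
    proof (rule AE_I2)
      fix t :: real
      have "((norm (fourier (ray \<beta>) t))\<^sup>2) ^ k \<le> (C * exp (- (c * \<bar>t\<bar>))) ^ k"
        using C by (intro power_mono) auto
      also have "\<dots> = C ^ k * exp (- (real k * c * \<bar>t\<bar>))"
        by (simp add: power_mult_distrib exp_of_nat_mult[symmetric] mult.assoc)
      finally show "norm (((norm (fourier (ray \<beta>) t))\<^sup>2) ^ k) \<le> norm (C ^ k * exp (- (real k * c * \<bar>t\<bar>)))"
        using C(1) by simp
    qed
  qed measurable
qed

lemma autocorr_ray:
  assumes "\<bar>\<beta>\<bar> < pi / 2"
  shows "autocorr (ray \<beta>) w = (1 / (2 * pi)) * (LINT t|lborel. of_real ((norm (fourier (ray \<beta>) t))\<^sup>2) * iexp (- w * t))"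
proof -
  obtain B where B: "\<And>y. norm (ray \<beta> y) \<le> B" using ray_bounded[OF assms] by blast
  note i = integrable_ray[OF assms] and c = continuous_ray[OF assms]
  have f: "fourier (autocorr (ray \<beta>)) = (\<lambda>t. of_real ((norm (fourier (ray \<beta>) t))\<^sup>2))"
    using fourier_autocorr[OF i] by auto
  have "autocorr (ray \<beta>) w = (1 / (2 * pi)) * fourier (fourier (autocorr (ray \<beta>))) (- w)"
  proof (rule fourier_inversion[OF autocorr_continuous[OF c i B] autocorr_bounded[OF i B] integrable_autocorr[OF i]])
    show "integrable lborel (fourier (autocorr (ray \<beta>)))"
      using integrable_norm_fourier_ray_power[OF assms, of 1] unfolding f by (simp del: of_real_power)
  qed
  then show ?thesis
    by (simp only: f fourier_def[where f = "\<lambda>t. of_real ((norm (fourier (ray \<beta>) t))\<^sup>2)"])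
qed

section \<open>Continuation of A\<close>

text \<open>
  The Fourier integral for the continuation of \<open>A\<close>. On the ray of argument \<open>\<alpha>\<close> the power of \<open>z\<close>
  contributes \<open>e\<^bsup>\<alpha>t\<^esup>\<close>, and the weight decays faster than \<open>e\<^bsup>-\<gamma>\<bar>t\<bar>\<^esup>\<close> for each \<open>\<gamma> < \<pi>\<close>;
  this is why it converges on the whole slit plane.
\<close>
definition A_mellin :: "complex \<Rightarrow> complex" where
  "A_mellin z = (1 / (2 * pi)) *
     (LINT t|lborel. of_real ((norm (fourier (ray 0) t))\<^sup>2) * z powr (- 1/2 - \<i> * of_real t))"

text \<open>
  On a compact disc in the slit plane the argument stays below some \<open>s < \<pi>\<close>; half of the gap
  between \<open>s\<close> and \<open>\<pi>\<close> is used as decay rate of the dominating function.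
\<close>
lemma A_mellin_holomorphic: "A_mellin holomorphic_on (- \<real>\<^sub>\<le>\<^sub>0)"
proof -
  have "(\<lambda>z. LINT t|lborel. of_real ((norm (fourier (ray 0) t))\<^sup>2) * z powr (- 1/2 - \<i> * of_real t)) holomorphic_on (- \<real>\<^sub>\<le>\<^sub>0)"
  proof (rule holomorphic_on_parametric_integral)
    show "open (- \<real>\<^sub>\<le>\<^sub>0 :: complex set)" by auto
    show "(\<lambda>z. of_real ((norm (fourier (ray 0) t))\<^sup>2) * z powr (- 1/2 - \<i> * of_real t)) holomorphic_on (- \<real>\<^sub>\<le>\<^sub>0)" for t
      by (intro holomorphic_intros) auto
    show "(\<lambda>t. of_real ((norm (fourier (ray 0) t))\<^sup>2) * z powr (- 1/2 - \<i> * of_real t)) \<in> borel_measurable lborel" for z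
      unfolding powr_def by measurable
    fix z :: complex assume z: "z \<in> - \<real>\<^sub>\<le>\<^sub>0"
    obtain r where r: "r > 0" "cball z r \<subseteq> - \<real>\<^sub>\<le>\<^sub>0"
      using z open_contains_cball[of "- \<real>\<^sub>\<le>\<^sub>0 :: complex set"] by auto
    have ne: "cball z r \<noteq> {}" using r by auto
    have "continuous_on (cball z r) (\<lambda>u. \<bar>Im (Ln u)\<bar>)" "continuous_on (cball z r) (\<lambda>u. \<bar>Re (Ln u)\<bar>)"
      using r by (auto intro!: continuous_intros)
    note co = this
    obtain u0 where u0: "u0 \<in> cball z r" "\<And>u. u \<in> cball z r \<Longrightarrow> \<bar>Im (Ln u)\<bar> \<le> \<bar>Im (Ln u0)\<bar>"
      using continuous_attains_sup[OF compact_cball ne co(1)] by blast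
    obtain u1 where u1: "\<And>u. u \<in> cball z r \<Longrightarrow> \<bar>Re (Ln u)\<bar> \<le> \<bar>Re (Ln u1)\<bar>"
      using continuous_attains_sup[OF compact_cball ne co(2)] by blast
    define s L where "s = \<bar>Im (Ln u0)\<bar>" and "L = \<bar>Re (Ln u1)\<bar>"
    have s: "s < pi" "s \<ge> 0"
    proof -
      have "u0 \<notin> \<real>\<^sub>\<le>\<^sub>0" using u0(1) r(2) by blast
      then have "u0 \<noteq> 0" by auto
      then have "- pi < Im (Ln u0)" "Im (Ln u0) \<le> pi" by (auto simp: mpi_less_Im_Ln Im_Ln_le_pi)
      moreover have "Im (Ln u0) \<noteq> pi"
        using Im_Ln_eq_pi[OF \<open>u0 \<noteq> 0\<close>] \<open>u0 \<notin> \<real>\<^sub>\<le>\<^sub>0\<close> by (auto simp: complex_nonpos_Reals_iff)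
      ultimately show "s < pi" unfolding s_def by linarith
    qed (simp add: s_def)
    define \<theta> where "\<theta> = (s + pi) / 4"
    obtain C where C: "C > 0" "\<And>t. norm (fourier (ray 0) t) \<le> C * exp (- (\<theta> * \<bar>t\<bar>))"
    proof -
      have "0 \<le> \<theta>" "\<theta> < pi / 2" using s by (auto simp: \<theta>_def)
      from norm_fourier_ray_decay[OF this] show ?thesis using that by blast
    qed
    define w where "w = (\<lambda>t::real. C\<^sup>2 * exp (L / 2) * exp (- ((pi - s) / 2 * \<bar>t\<bar>)))"
    have b: "norm (of_real ((norm (fourier (ray 0) t))\<^sup>2) * u powr (- 1/2 - \<i> * of_real t)) \<le> w t"
      if u: "u \<in> cball z r" for u t
    proof -
      have "u \<notin> \<real>\<^sub>\<le>\<^sub>0" using u r(2) by blast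
      then have "u \<noteq> 0" by auto
      then have "norm (u powr (- 1/2 - \<i> * of_real t)) = exp (- Re (Ln u) / 2 + t * Im (Ln u))"
        by (simp add: powr_def)
      also have "\<dots> \<le> exp (L / 2 + s * \<bar>t\<bar>)"
      proof -
        have "t * Im (Ln u) \<le> \<bar>t\<bar> * s"
          using u0(2)[OF u] unfolding s_def
          by (metis abs_ge_self abs_ge_zero abs_mult mult_left_mono order_trans)
        moreover have "- Re (Ln u) \<le> L" using u1[OF u] unfolding L_def by linarith
        ultimately show ?thesis by (simp add: mult.commute)
      qed
      finally have p: "norm (u powr (- 1/2 - \<i> * of_real t)) \<le> exp (L / 2 + s * \<bar>t\<bar>)" .
      have "(norm (fourier (ray 0) t))\<^sup>2 \<le> (C * exp (- (\<theta> * \<bar>t\<bar>)))\<^sup>2"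
        using C by (intro power_mono) auto
      then have "norm (of_real ((norm (fourier (ray 0) t))\<^sup>2) * u powr (- 1/2 - \<i> * of_real t)) \<le> (C * exp (- (\<theta> * \<bar>t\<bar>)))\<^sup>2 * exp (L / 2 + s * \<bar>t\<bar>)"
        using p by (auto simp: norm_mult norm_power intro!: mult_mono)
      also have "\<dots> = w t"
      proof -
        have "(C * exp (- (\<theta> * \<bar>t\<bar>)))\<^sup>2 * exp (L / 2 + s * \<bar>t\<bar>) = C\<^sup>2 * (exp (2 * (- (\<theta> * \<bar>t\<bar>))) * exp (L / 2 + s * \<bar>t\<bar>))"
          by (simp only: power_mult_distrib exp_double mult.assoc)
        also have "exp (2 * (- (\<theta> * \<bar>t\<bar>))) * exp (L / 2 + s * \<bar>t\<bar>) = exp (L / 2) * exp (- ((pi - s) / 2 * \<bar>t\<bar>))"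
          unfolding exp_add[symmetric] by (simp add: \<theta>_def field_simps)
        finally show ?thesis by (simp add: w_def)
      qed
      finally show ?thesis .
    qed
    have "integrable lborel w"
      unfolding w_def using s by (intro integrable_mult_right integrable_exp_minus_abs) auto
    with b r show "\<exists>r>0. \<exists>w. integrable lborel w \<and> cball z r \<subseteq> - \<real>\<^sub>\<le>\<^sub>0 \<and> (\<forall>t\<in>space lborel. \<forall>u\<in>cball z r.
       norm (of_real ((norm (fourier (ray 0) t))\<^sup>2) * u powr (- 1/2 - \<i> * of_real t)) \<le> w t)"
      by blast
  qed
  then show ?thesis unfolding A_mellin_def by (intro holomorphic_intros)
qed

lemma A_integral_eq_phi:
  "A_integral z = (LINT y|lborel. of_real (exp y) * (phi (of_real (exp y) * z) * phi (of_real (exp y))))"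
proof -
  have "A_integral z = (LINT x:{0<..}|lborel. phi (of_real x * z) * phi (of_real x))"
    by (simp add: A_integral_def phi_def exp_of_real[symmetric] del: exp_of_real)
  also have "\<dots> = (LINT y|lborel. of_real (exp y) * (phi (of_real (exp y) * z) * phi (of_real (exp y))))"
    by (rule set_integral_exp_substitution(2)) measurable
  finally show ?thesis .
qed

lemma A_integral_holomorphic: "A_integral holomorphic_on {z. Re z > 0}"
  unfolding A_integral_eq_phi[abs_def]
proof (rule holomorphic_on_parametric_integral)
  show "open {z. Re z > 0}" by (rule open_halfspace_Re_gt)
  fix y :: real
  have "(\<lambda>z. phi (of_real (exp y) * z)) holomorphic_on {z. Re z > 0}"
    by (rule holomorphic_on_compose_gen[OF _ phi_holomorphic, unfolded comp_def]) (auto intro!: holomorphic_intros)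
  then show "(\<lambda>z. of_real (exp y) * (phi (of_real (exp y) * z) * phi (of_real (exp y)))) holomorphic_on {z. Re z > 0}"
    by (intro holomorphic_intros)
next
  fix z :: complex assume "z \<in> {z. Re z > 0}"
  then have "Re z > 0" by simp
  from phi_exp_bound_cball[OF this] obtain r D where r: "r > 0" "cball z r \<subseteq> {z. Re z > 0}" and D: "D > 0"
    "\<And>y u. u \<in> cball z r \<Longrightarrow>
        exp (y / 2) * norm (phi (of_real (exp y) * u)) \<le> D * exp (- (1/2 * \<bar>y\<bar>))"
    by blast
  from phi_exp_bound[of 1 1] obtain D' where
    D': "D' > 0" "\<And>y. exp (y / 2) * norm (phi (of_real (exp y))) \<le> D' * exp (- (1/2 * \<bar>y\<bar>))"
    by (metis zero_less_one one_complex.sel(1) norm_one order_refl mult_1_right)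
  show "\<exists>r>0. \<exists>w. integrable lborel w \<and> cball z r \<subseteq> {z. Re z > 0} \<and>
      (\<forall>y\<in>space lborel. \<forall>u\<in>cball z r. norm (of_real (exp y) * (phi (of_real (exp y) * u) * phi (of_real (exp y)))) \<le> w y)"
  proof (intro exI[of _ r] exI[of _ "\<lambda>y. D * D' * exp (- (1 * \<bar>y\<bar>))"] conjI ballI)
    show "integrable lborel (\<lambda>y. D * D' * exp (- (1 * \<bar>y\<bar>)))"
      by (intro integrable_mult_right integrable_exp_minus_abs) auto
    fix y :: real and v assume v: "v \<in> cball z r"
    have "norm (of_real (exp y) * (phi (of_real (exp y) * v) * phi (of_real (exp y))))
       = (exp (y / 2) * norm (phi (of_real (exp y) * v))) * (exp (y / 2) * norm (phi (of_real (exp y))))"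
    proof -
      have "exp y = exp (y / 2) * exp (y / 2)" by (simp add: exp_add[symmetric])
      then show ?thesis by (simp add: norm_mult)
    qed
    also have "\<dots> \<le> (D * exp (- (1/2 * \<bar>y\<bar>))) * (D' * exp (- (1/2 * \<bar>y\<bar>)))"
      using D(2)[OF v, of y] D'(2)[of y] D(1) by (intro mult_mono[of "_ * _" "_ * _" "_ * _" "_ * _"]) auto
    also have "\<dots> = D * D' * exp (- (1 * \<bar>y\<bar>))"
      by (simp add: exp_add[symmetric] mult_ac)
    finally show "norm (of_real (exp y) * (phi (of_real (exp y) * v) * phi (of_real (exp y)))) \<le> D * D' * exp (- (1 * \<bar>y\<bar>))" .
  qed (rule r)+
qed measurable

text \<open>
  Splitting the measure \<open>e\<^sup>y dy\<close> evenly between the two factors turns the integral into an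
  autocorrelation with shift \<open>ln x\<close>.
\<close>
lemma A_integral_real:
  assumes "x > 0"
  shows "A_integral (of_real x) = A_mellin (of_real x)"
proof -
  let ?c = "complex_of_real (exp (- ln x / 2))"
  have e: "of_real (exp y) * (phi (of_real (exp y) * of_real x) * phi (of_real (exp y))) = ?c * (ray 0 (y + ln x) * cnj (ray 0 y))" for y
  proof -
    have "exp y = exp (- ln x / 2) * exp ((y + ln x) / 2) * exp (y / 2)"
      by (simp add: exp_add[symmetric] field_simps)
    moreover have "exp (y + ln x) = exp y * x" using assms by (simp add: exp_add)
    ultimately show ?thesis unfolding cnj_ray_0 by (simp add: ray_def del: exp_of_real)
  qed
  have "A_integral (of_real x) = ?c * autocorr (ray 0) (ln x)"
    unfolding A_integral_eq_phi e integral_mult_right_zero autocorr_def ..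
  also have "\<dots> = (1 / (2 * pi)) * (LINT t|lborel. ?c * (of_real ((norm (fourier (ray 0) t))\<^sup>2) * iexp (- ln x * t)))"
    unfolding integral_mult_right_zero by (subst autocorr_ray) auto
  also have "\<dots> = A_mellin (of_real x)"
  proof -
    have "?c * (of_real ((norm (fourier (ray 0) t))\<^sup>2) * iexp (- ln x * t)) =
      of_real ((norm (fourier (ray 0) t))\<^sup>2) * of_real x powr (- 1/2 - \<i> * of_real t)" for t
    proof -
      have "of_real x powr (- 1/2 - \<i> * of_real t) = ?c * iexp (- ln x * t)"
        using assms by (simp add: powr_def Ln_of_real exp_of_real[symmetric] exp_add[symmetric] algebra_simps del: exp_of_real)
      then show ?thesis by (simp only: mult_ac)
    qed
    then show ?thesis unfolding A_mellin_def by (simp only:)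
  qed
  finally show ?thesis .
qed

text \<open>
  The defining integral and \<open>A_mellin\<close> are holomorphic in the right half-plane and agree on the
  positive axis, hence by the identity theorem in the whole half-plane.
\<close>
lemma A_fun_eq: "A_fun = (\<lambda>z. if z \<in> \<real>\<^sub>\<le>\<^sub>0 then 0 else A_mellin z)"
  unfolding A_fun_def
proof (rule analytic_continuation_eqI)
  show "open {z. 0 < Re z}" by (rule open_halfspace_Re_gt)
  show "{z. 0 < Re z} \<noteq> {}" by (auto intro!: exI[of _ 1])
  show sub: "{z. 0 < Re z} \<subseteq> - \<real>\<^sub>\<le>\<^sub>0" by (auto simp: complex_nonpos_Reals_iff)
  show "open (- \<real>\<^sub>\<le>\<^sub>0 :: complex set)" by auto
  show "connected (- \<real>\<^sub>\<le>\<^sub>0 :: complex set)"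
  proof -
    have "(\<real>\<^sub>\<le>\<^sub>0 :: complex set) = complex_of_real ` {..0}" by (auto simp: nonpos_Reals_def)
    then show ?thesis using starlike_imp_connected[OF starlike_slotted_complex_plane_left[of 0]] by simp
  qed
  show "(\<lambda>z. if z \<in> \<real>\<^sub>\<le>\<^sub>0 then 0 else A_mellin z) holomorphic_on - \<real>\<^sub>\<le>\<^sub>0"
    by (rule holomorphic_transform[OF A_mellin_holomorphic]) auto
  fix z :: complex assume z: "z \<in> {z. 0 < Re z}"
  have "A_mellin z - A_integral z = 0"
  proof (rule analytic_continuation[where S = "{z. Re z > 0}" and U = "of_real ` {0<..}" and \<xi> = 1
      and f = "\<lambda>z. A_mellin z - A_integral z"])
    show "(\<lambda>z. A_mellin z - A_integral z) holomorphic_on {z. Re z > 0}"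
      by (intro holomorphic_intros A_integral_holomorphic holomorphic_on_subset[OF A_mellin_holomorphic sub])
    show "open {z. Re z > 0}" by (rule open_halfspace_Re_gt)
    show "connected {z. Re z > 0}" by (rule convex_connected[OF convex_halfspace_Re_gt])
    show "of_real ` {0<..} \<subseteq> {z. 0 < Re z}" by auto
    show "(1::complex) islimpt of_real ` {0<..}" by (rule one_islimpt_positive_reals)
  qed (use z A_integral_real in auto)
  then show "(if z \<in> \<real>\<^sub>\<le>\<^sub>0 then 0 else A_mellin z) = A_integral z" using z sub by auto
qed auto

text \<open>
  The factor \<open>e\<^bsup>-(\<pi>-\<delta>)t\<^esup>\<close> that the argument of \<open>z\<close> puts into the integral for \<open>A\<close> is
  \<open>(e\<^bsup>\<beta>t\<^esup>)\<^sup>2\<close> with \<open>\<beta> = -(\<pi>-\<delta>)/2\<close>, and \<open>\<bar>\<beta>\<bar> < \<pi>/2\<close>. So the ray, although it may lie in the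
  left half-plane, is reached by an autocorrelation along a ray in the right half-plane.
\<close>
lemma A_fun_on_ray:
  assumes "0 < \<delta>" "\<delta> < pi" "u > 0"
  shows "A_fun (- of_real u * exp (\<i> * of_real \<delta>)) =
    of_real (u powr (- 1/2)) * exp (\<i> * of_real ((pi - \<delta>) / 2)) * autocorr (ray (- (pi - \<delta>) / 2)) (ln u)"
proof -
  let ?z = "- of_real u * exp (\<i> * complex_of_real \<delta>)"
  let ?al = "pi - \<delta>"
  let ?\<beta> = "- ?al / 2"
  have z: "?z = exp (of_real (ln u) - \<i> * of_real ?al)"
  proof -
    have "exp (of_real (ln u) - \<i> * of_real ?al) = exp (of_real (ln u)) * exp (\<i> * of_real \<delta> - \<i> * of_real pi)"
      by (simp add: exp_add[symmetric] algebra_simps)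
    also have "\<dots> = of_real u * (exp (\<i> * of_real \<delta>) / exp (\<i> * of_real pi))"
      using assms by (simp add: exp_of_real exp_diff)
    also have "exp (\<i> * complex_of_real pi) = - 1" by (simp add: exp_Euler)
    finally show ?thesis by simp
  qed
  have L: "Ln ?z = of_real (ln u) - \<i> * of_real ?al"
    unfolding z using assms by (intro Ln_exp) auto
  have nz: "?z \<noteq> 0" using assms by simp
  have np: "?z \<notin> \<real>\<^sub>\<le>\<^sub>0"
  proof
    assume "?z \<in> \<real>\<^sub>\<le>\<^sub>0"
    then have "Im (Ln ?z) = pi" using nz Im_Ln_eq_pi[OF nz] by (auto simp: complex_nonpos_Reals_iff complex_eq_iff)
    then show False unfolding L using assms by simp
  qed
  have b: "\<bar>?\<beta>\<bar> < pi / 2" using assms by simp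
  let ?c = "of_real (u powr (- 1/2)) * exp (\<i> * of_real (?al / 2))"
  have "A_fun ?z = A_mellin ?z" using np by (simp add: A_fun_eq)
  also have "\<dots> = (1 / (2 * pi)) * (LINT t|lborel. ?c * (of_real ((norm (fourier (ray ?\<beta>) t))\<^sup>2) * iexp (- ln u * t)))"
  proof -
    have "of_real ((norm (fourier (ray 0) t))\<^sup>2) * ?z powr (- 1/2 - \<i> * of_real t) =
      ?c * (of_real ((norm (fourier (ray ?\<beta>) t))\<^sup>2) * iexp (- ln u * t))" for t
    proof -
      have "?z powr (- 1/2 - \<i> * of_real t) = exp ((- 1/2 - \<i> * of_real t) * (of_real (ln u) - \<i> * of_real ?al))"
        unfolding powr_def L using nz by simp
      also have "\<dots> = exp (of_real (- 1/2 * ln u)) * exp (\<i> * of_real (?al / 2)) * exp (of_real (- ?al * t)) * iexp (- ln u * t)"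
        unfolding exp_add[symmetric] by (rule arg_cong[of _ _ exp]) (simp add: algebra_simps complex_eq_iff)
      also have "exp (of_real (- 1/2 * ln u)) = complex_of_real (u powr (- 1/2))"
        unfolding exp_of_real using assms by (simp add: powr_def)
      finally have 1: "?z powr (- 1/2 - \<i> * of_real t) = ?c * exp (of_real (- ?al * t)) * iexp (- ln u * t)" .
      have 2: "(norm (fourier (ray ?\<beta>) t))\<^sup>2 = exp (- ?al * t) * (norm (fourier (ray 0) t))\<^sup>2"
        unfolding norm_fourier_ray[OF b] power_mult_distrib exp_double[symmetric] by simp
      show ?thesis unfolding 1 2 by (simp add: exp_of_real[symmetric] mult_ac del: exp_of_real)
    qed
    then show ?thesis unfolding A_mellin_def by (simp only:)
  qed
  also have "\<dots> = ?c * autocorr (ray ?\<beta>) (ln u)"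
    unfolding autocorr_ray[OF b] integral_mult_right_zero by (simp only: mult_ac)
  finally show ?thesis .
qed

section \<open>Convolutions on the multiplicative group\<close>

lemma product_sigma_finite_mult_haar: "product_sigma_finite (\<lambda>_. mult_haar)"
  by (intro product_sigma_finite.intro sigma_finite_mult_haar)

lemma measurable_mult_haar_component:
  assumes "j \<in> I"
  shows "(\<lambda>u. u j) \<in> borel_measurable (Pi\<^sub>M I (\<lambda>_. mult_haar))"
proof -
  have "(\<lambda>u. u j) \<in> Pi\<^sub>M I (\<lambda>_. mult_haar) \<rightarrow>\<^sub>M restrict_space borel {0<..}"
    using measurable_component_singleton[OF assms, of "\<lambda>_. mult_haar"]
    by (subst measurable_cong_sets[OF refl sets_mult_haar[symmetric]])
  then show ?thesis by (simp add: measurable_restrict_space2_iff)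
qed

text \<open>
  Only the last factor is replaced by its inverse Fourier integral. The character
  \<open>e\<^bsup>it(x\<^sub>1 + \<cdots> + x\<^sub>m)\<^esup>\<close> then splits over the coordinates, and one application of Fubini leaves a
  product of \<open>m\<close> Fourier transforms at \<open>t\<close>.
\<close>
lemma multiplicative_convolution_at_1:
  fixes a :: "real \<Rightarrow> complex" and m :: nat
  assumes int: "integrable lborel a" and hat: "integrable lborel (fourier a)"
    and bdd: "\<And>x. norm (a x) \<le> B"
    and inv: "\<And>x. a x = (1 / (2 * pi)) * fourier (fourier a) (- x)"
  defines "N \<equiv> Pi\<^sub>M {..<m} (\<lambda>_. mult_haar)"
  shows "integrable N (\<lambda>u. (\<Prod>j<m. a (ln (u j))) * a (- (\<Sum>j<m. ln (u j))))"
    and "(LINT u|N. (\<Prod>j<m. a (ln (u j))) * a (- (\<Sum>j<m. ln (u j)))) =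
           (1 / (2 * pi)) * (LINT t|lborel. fourier a t ^ Suc m)"
proof -
  interpret ps: product_sigma_finite "\<lambda>_::nat. mult_haar" by (rule product_sigma_finite_mult_haar)
  have sfN: "sigma_finite_measure N" unfolding N_def by (rule ps.sigma_finite) simp
  interpret P: pair_sigma_finite N lborel
    by (intro pair_sigma_finite.intro sfN sigma_finite_lborel)
  have [measurable]: "a \<in> borel_measurable borel" using int by (auto dest: borel_measurable_integrable)
  have comp [measurable]: "(\<lambda>u. u j) \<in> borel_measurable N" if "j \<in> {..<m}" for j
    unfolding N_def by (rule measurable_mult_haar_component[OF that])
  define S where "S = (\<lambda>u::nat \<Rightarrow> real. \<Sum>j<m. ln (u j))"
  define p where "p = (\<lambda>u::nat \<Rightarrow> real. \<Prod>j<m. a (ln (u j)))"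
  have [measurable]: "S \<in> borel_measurable N" unfolding S_def by measurable
  have one: "integrable mult_haar (\<lambda>v. a (ln v))" using mult_haar_ln(1)[of a] int by simp
  have pint: "integrable N p"
    unfolding p_def N_def by (rule ps.product_integrable_prod) (auto intro: one)
  have "integrable N (\<lambda>u. p u * a (- S u))"
    by (rule integrable_mult_bounded[OF pint _ bdd]) measurable
  then show "integrable N (\<lambda>u. (\<Prod>j<m. a (ln (u j))) * a (- (\<Sum>j<m. ln (u j))))"
    by (simp only: p_def S_def)
  have Fint: "integrable (N \<Otimes>\<^sub>M lborel) (\<lambda>(u, t). p u * fourier a t * iexp (t * S u))"
  proof -
    have "integrable (N \<Otimes>\<^sub>M lborel) (\<lambda>q. (case q of (u, t) \<Rightarrow> p u * fourier a t) * iexp (snd q * S (fst q)))"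
      by (rule integrable_mult_bounded[OF P.integrable_tensor[OF pint hat], where B = 1]) auto
    then show ?thesis by (simp only: split_beta')
  qed
  have "(LINT u|N. p u * a (- S u)) = (LINT u|N. (1 / (2 * pi)) * (LINT t|lborel. p u * fourier a t * iexp (t * S u)))"
  proof (rule Bochner_Integration.integral_cong[OF refl])
    fix u
    have "(LINT t|lborel. p u * fourier a t * iexp (t * S u)) = p u * fourier (fourier a) (S u)"
      unfolding fourier_def[of "fourier a"] integral_mult_right_zero[symmetric] by (simp only: mult_ac)
    then show "p u * a (- S u) = (1 / (2 * pi)) * (LINT t|lborel. p u * fourier a t * iexp (t * S u))"
      using inv[of "- S u"] by simp
  qed
  also have "\<dots> = (1 / (2 * pi)) * (LINT u|N. (LINT t|lborel. p u * fourier a t * iexp (t * S u)))"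
    by (rule integral_mult_right_zero)
  also have "(LINT u|N. (LINT t|lborel. p u * fourier a t * iexp (t * S u))) = (LINT t|lborel. (LINT u|N. p u * fourier a t * iexp (t * S u)))"
    by (rule P.Fubini_integral[OF Fint, symmetric])
  also have "\<dots> = (LINT t|lborel. fourier a t ^ Suc m)"
  proof (rule Bochner_Integration.integral_cong[OF refl])
    fix t :: real
    let ?h = "\<lambda>v. a (ln v) * iexp (t * ln v)"
    have h: "integrable mult_haar ?h" "integral\<^sup>L mult_haar ?h = fourier a t"
      using mult_haar_ln[of "\<lambda>y. a y * iexp (t * y)"] integrable_iexp_mult[OF int, of t]
      by (auto simp: fourier_def)
    have "p u * fourier a t * iexp (t * S u) = fourier a t * (\<Prod>j<m. ?h (u j))" for u
    proof -
      have "iexp (t * S u) = exp (\<Sum>j<m. \<i> * complex_of_real (t * ln (u j)))"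
        by (simp add: S_def sum_distrib_left)
      also have "\<dots> = (\<Prod>j<m. iexp (t * ln (u j)))" by (rule exp_sum) simp
      finally show ?thesis by (simp only: p_def prod.distrib mult_ac)
    qed
    then have "(LINT u|N. p u * fourier a t * iexp (t * S u)) = fourier a t * (LINT u|N. (\<Prod>j<m. ?h (u j)))"
      by (simp only: integral_mult_right_zero)
    also have "(LINT u|N. (\<Prod>j<m. ?h (u j))) = (\<Prod>j<m. integral\<^sup>L mult_haar ?h)"
      unfolding N_def by (rule ps.product_integral_prod) (simp, rule h(1))
    also have "\<dots> = fourier a t ^ m" by (simp only: h(2) prod_constant card_lessThan)
    finally show "(LINT u|N. p u * fourier a t * iexp (t * S u)) = fourier a t ^ Suc m"
      by (simp only: power_Suc)
  qed
  finally show "(LINT u|N. (\<Prod>j<m. a (ln (u j))) * a (- (\<Sum>j<m. ln (u j)))) =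
           (1 / (2 * pi)) * (LINT t|lborel. fourier a t ^ Suc m)"
    by (simp only: p_def S_def)
qed

definition delta1_map :: "nat \<Rightarrow> (nat \<Rightarrow> real) \<Rightarrow> nat \<Rightarrow> real" where
  "delta1_map k u = (\<lambda>j\<in>{..<k}. if j < k - 1 then u j else inverse (\<Prod>i<k - 1. u i))"

text \<open>
  The coordinates have product 1, so the powers \<open>v\<^sup>r\<close> cancel and the logarithm of the last
  coordinate is minus the sum of the others.
\<close>
lemma prod_delta1_map:
  assumes "u \<in> space (Pi\<^sub>M {..<m} (\<lambda>_. mult_haar))" "c ^ Suc m = C"
    and f: "\<And>v. v > 0 \<Longrightarrow> f v = of_real (v powr r) * c * a (ln v)"
  shows "(\<Prod>j<Suc m. f (delta1_map (Suc m) u j)) =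
      C * ((\<Prod>j<m. a (ln (u j))) * (a (- (\<Sum>j<m. ln (u j))) :: complex))"
proof -
  have pos: "u j > 0" if "j < m" for j
    using assms(1) that by (auto simp: space_PiM space_mult_haar)
  define q where "q = (\<Prod>i<m. u i)"
  have q: "q > 0" unfolding q_def using pos by (intro prod_pos) auto
  have lnq: "ln (inverse q) = - (\<Sum>j<m. ln (u j))"
  proof -
    have "ln q = (\<Sum>j<m. ln (u j))" unfolding q_def using pos by (intro ln_prod) force+
    then show ?thesis using q by (simp add: ln_inverse)
  qed
  have "(\<Prod>j<Suc m. f (delta1_map (Suc m) u j)) = (\<Prod>j<m. f (u j)) * f (inverse q)"
    by (simp add: delta1_map_def q_def)
  also have "(\<Prod>j<m. f (u j)) = (\<Prod>j<m. of_real (u j powr r) * c * a (ln (u j)))"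
    using f pos by (intro prod.cong) auto
  also have "\<dots> = of_real (q powr r) * c ^ m * (\<Prod>j<m. a (ln (u j)))"
  proof -
    have "(\<Prod>j<m. u j powr r) = q powr r" unfolding q_def
      using pos by (subst prod_powr_distrib) (auto intro: less_imp_le)
    then show ?thesis by (simp add: prod.distrib flip: of_real_prod)
  qed
  also have "\<dots> * f (inverse q) = (of_real (q powr r) * of_real (inverse q powr r)) * c ^ Suc m * ((\<Prod>j<m. a (ln (u j))) * a (ln (inverse q)))"
    using f[of "inverse q"] q by simp
  also have "of_real (q powr r) * of_real (inverse q powr r) = (1 :: complex)"
    using q by (simp add: powr_mult[symmetric] flip: of_real_mult)
  finally show ?thesis unfolding lnq assms(2) by simp
qed

theorem theorem1p1:
  fixes k :: nat and \<delta> :: real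
  assumes "k \<ge> 1" and "0 < \<delta>" and "\<delta> < pi"
  defines "F \<equiv> \<lambda>t::real. cmod (zeta (1/2 + \<i> * of_real t)) ^ (2 * k) *
                  (exp (real k * (pi - \<delta>) * t) / cosh (pi * t) ^ k)"
    and "G \<equiv> \<lambda>u::nat \<Rightarrow> real. \<Prod>j<k. A_fun (- of_real (u j) * exp (\<i> * of_real \<delta>))"
  shows "integrable lborel F \<and> integrable (delta1_measure k) G \<and>
    complex_of_real (LINT t|lborel. F t) =
      2 * (exp (\<i> * of_nat k * of_real ((\<delta> - pi) / 2)) / of_real pi ^ (k - 1)) *
        (LINT u|delta1_measure k. G u)"
proof -
  define m where "m = k - 1"
  have k: "k = Suc m" using assms(1) by (simp add: m_def)
  define \<beta> where "\<beta> = (pi - \<delta>) / 2"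
  have b: "\<bar>\<beta>\<bar> < pi / 2" "\<bar>- \<beta>\<bar> < pi / 2" using assms(2,3) by (auto simp: \<beta>_def)
  define P where "P = (\<lambda>t. (norm (fourier (ray \<beta>) t))\<^sup>2)"
  have F: "F t = P t ^ k / pi ^ k" for t
    unfolding F_def P_def norm_fourier_ray_sq[OF b(1)]
    by (simp add: \<beta>_def power_mult power_mult_distrib power_divide exp_of_nat_mult[symmetric] mult.assoc)
  have Pk: "integrable lborel (\<lambda>t. P t ^ k)"
    unfolding P_def by (rule integrable_norm_fourier_ray_power[OF b(1) assms(1)])
  have iF: "integrable lborel F" unfolding F[abs_def] using Pk by simp
  define a where "a = autocorr (ray (- \<beta>))"
  obtain B where B: "\<And>y. norm (ray (- \<beta>) y) \<le> B" using ray_bounded[OF b(2)] by blast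
  note ir = integrable_ray[OF b(2)] and cr = continuous_ray[OF b(2)]
  (* The integral for A is written with the power -1/2 - it of z, the theorem with +it, whence the
     reflection of the variable t here and below. *)
  have fa: "fourier a = (\<lambda>t. of_real (P (- t)))"
    using fourier_autocorr[OF ir] norm_fourier_ray_uminus[OF b(1), of "- _"] by (auto simp: a_def P_def)
  have a: "integrable lborel a" "continuous_on UNIV a" "\<And>w. norm (a w) \<le> B * (LINT y|lborel. norm (ray (- \<beta>) y))"
    unfolding a_def by (rule integrable_autocorr[OF ir] autocorr_continuous[OF cr ir B] autocorr_bounded[OF ir B])+
  have P1: "integrable lborel P"
    using integrable_norm_fourier_ray_power[OF b(1), of 1] by (simp add: P_def)
  have hat: "integrable lborel (fourier a)"
    unfolding fa using lborel_integrable_real_affine[OF P1, of "-1" 0] by simp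
  note conv = multiplicative_convolution_at_1[OF a(1) hat a(3) fourier_inversion[OF a(2,3,1) hat], of m]
  define c where "c = exp (\<i> * of_real \<beta>)"
  (* The phases of the k factors combine to C, the inverse of the exponential prefactor. *)
  define C where "C = c ^ Suc m"
  have A: "A_fun (- of_real v * exp (\<i> * of_real \<delta>)) = of_real (v powr (- 1/2)) * c * a (ln v)" if "v > 0" for v
  proof -
    have "- (pi - \<delta>) / 2 = - \<beta>" by (simp add: \<beta>_def minus_divide_left)
    then show ?thesis
      using A_fun_on_ray[OF assms(2,3) that] unfolding c_def a_def \<beta>_def[symmetric] by (simp only:)
  qed
  let ?N = "Pi\<^sub>M {..<m} (\<lambda>_. mult_haar)" and ?R = "Pi\<^sub>M {..<k} (\<lambda>_. restrict_space lborel {0::real<..})"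
  have T: "delta1_map k \<in> ?N \<rightarrow>\<^sub>M ?R"
    using delta1_map_measurable[of k] by (simp add: delta1_map_def[abs_def] m_def)
  have D: "delta1_measure k = distr ?N ?R (delta1_map k)"
    by (simp add: delta1_measure_def delta1_map_def[abs_def] m_def)
  have G: "G (delta1_map k u) = C * ((\<Prod>j<m. a (ln (u j))) * a (- (\<Sum>j<m. ln (u j))))" if "u \<in> space ?N" for u
    unfolding G_def k by (rule prod_delta1_map[OF that C_def[symmetric]]) (rule A)
  have Gm: "G \<in> borel_measurable ?R"
  proof -
    have [measurable]: "a \<in> borel_measurable borel" using a(1) by (auto dest: borel_measurable_integrable)
    have [measurable]: "(\<lambda>u. u j) \<in> borel_measurable ?R" if "j \<in> {..<k}" for j
    proof -
      have "(\<lambda>u. u j) \<in> ?R \<rightarrow>\<^sub>M restrict_space lborel {0<..}"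
        by (rule measurable_component_singleton[OF that])
      then show ?thesis by (auto simp: measurable_restrict_space2_iff)
    qed
    have "(\<lambda>u. \<Prod>j<k. of_real (u j powr (- 1/2)) * c * a (ln (u j))) \<in> borel_measurable ?R"
      by measurable
    moreover have "G u = (\<Prod>j<k. of_real (u j powr (- 1/2)) * c * a (ln (u j)))" if "u \<in> space ?R" for u
      unfolding G_def using that by (intro prod.cong refl A) (auto simp: space_PiM space_restrict_space)
    ultimately show ?thesis by (simp cong: measurable_cong)
  qed
  have iG: "integrable (delta1_measure k) G"
  proof -
    have "integrable ?N (\<lambda>u. G (delta1_map k u))"
      by (rule Bochner_Integration.integrable_cong[THEN iffD2, OF refl G integrable_mult_right[OF conv(1)]])
    then show ?thesis unfolding D by (subst integrable_distr_eq[OF T Gm])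
  qed
  have "(LINT u|delta1_measure k. G u) = (LINT u|?N. G (delta1_map k u))"
    unfolding D by (rule integral_distr[OF T Gm])
  also have "\<dots> = (LINT u|?N. C * ((\<Prod>j<m. a (ln (u j))) * a (- (\<Sum>j<m. ln (u j)))))"
    by (rule Bochner_Integration.integral_cong[OF refl G])
  also have "\<dots> = C * ((1 / (2 * pi)) * (LINT t|lborel. fourier a t ^ k))"
    unfolding integral_mult_right_zero conv(2) k ..
  also have "(LINT t|lborel. fourier a t ^ k) = of_real (LINT t|lborel. P (- t) ^ k)"
    unfolding fa of_real_power[symmetric] by (rule integral_complex_of_real)
  also have "(LINT t|lborel. P (- t) ^ k) = (LINT t|lborel. P t ^ k)"
    using lborel_integral_real_affine[of "-1" "\<lambda>t. P t ^ k" 0] by simp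
  also have "\<dots> = pi ^ k * (LINT t|lborel. F t)"
    unfolding F[abs_def] by simp
  finally have I: "(LINT u|delta1_measure k. G u) = C * (complex_of_real (1 / (2 * pi)) * complex_of_real (pi ^ k * (LINT t|lborel. F t)))" .
  have "exp (\<i> * of_nat k * of_real ((\<delta> - pi) / 2)) * C = 1"
  proof -
    have "C = exp (of_nat k * (\<i> * of_real \<beta>))" unfolding C_def c_def k by (rule exp_of_nat_mult[symmetric])
    then show ?thesis by (simp add: exp_add[symmetric] \<beta>_def algebra_simps add_divide_distrib diff_divide_distrib)
  qed
  then have "2 * (exp (\<i> * of_nat k * of_real ((\<delta> - pi) / 2)) / of_real pi ^ (k - 1)) * (LINT u|delta1_measure k. G u)
      = 2 * (1 / of_real pi ^ m) * (complex_of_real (1 / (2 * pi)) * complex_of_real (pi ^ k * (LINT t|lborel. F t)))"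
    unfolding I m_def[symmetric] by (simp add: field_simps)
  also have "\<dots> = of_real (LINT t|lborel. F t)" unfolding k by simp
  finally show ?thesis using iF iG by simp
qed

end
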